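(* Let $\alpha\in\mathbb{R}$, $0<p_0<p,q<\infty$ (that is, $0<p_0<p<\infty$ and $p_0<q<\infty$), $0<\lambda<\min\{\alpha+n/p,\alpha+m/p\}$, and $$\max\left\{-\frac np,-\frac mp\right\}<\alpha<\min\left\{n\left(\frac1{p_0}-\frac1p\right),m\left(\frac1{p_0}-\frac1p\right)\right\}.$$ Put $X=B\vec{\dot K}_{(p/p_0)',(q/p_0)'}^{-p_0\alpha,\,p_0\lambda}(\mathbb{R}^n\times\mathbb{R}^m)$. Let $T$ be an operator such that for every $h\in X$, $h\neq0$, with $\|h\|_X\le1$, $T$ is bounded on $L^{p_0}(\mathbb{R}^n\times\mathbb{R}^m,\mathfrak{R}h)$ with a bound independent of $h$; that is, there is $C>0$ such that for all such $h$ and all $f\in L^{p_0}(\mathbb{R}^n\times\mathbb{R}^m,\mathfrak{R}h)$, $Tf$ is a well-defined measurable function and $\|Tf\|_{L^{p_0}(\mathfrak{R}h)}\le C\|f\|_{L^{p_0}(\mathfrak{R}h)}$. Then $T$ can be extended to a bounded operator on $M\vec{\dot K}_{p,q}^{\alpha,\lambda}(\mathbb{R}^n\times\mathbb{R}^m)$: there is $C'>0$ with $\|Tf\|_{M\vec{\dot K}_{p,q}^{\alpha,\lambda}}\le C'\|f\|_{M\vec{\dot K}_{p,q}^{\alpha,\lambda}}$ for all $f\in M\vec{\dot K}_{p,q}^{\alpha,\lambda}(\mathbb{R}^n\times\mathbb{R}^m)$. Moreover, there is $C''>0$ such that for all sequences $(f_i)_{i\in\mathbb{N}}$ in $M\vec{\dot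 K}_{p,q}^{\alpha,\lambda}(\mathbb{R}^n\times\mathbb{R}^m)$, $$\left\|\Big(\sum_{i\in\mathbb{N}}|Tf_i|^{p_0}\Big)^{1/p_0}\right\|_{M\vec{\dot K}_{p,q}^{\alpha,\lambda}(\mathbb{R}^n\times\mathbb{R}^m)}\le C''\left\|\Big(\sum_{i\in\mathbb{N}}|f_i|^{p_0}\Big)^{1/p_0}\right\|_{M\vec{\dot K}_{p,q}^{\alpha,\lambda}(\mathbb{R}^n\times\mathbb{R}^m)}.$$
   Context: $n,m$ are positive integers; $r'$ is the conjugate exponent of $r$. For a weight $\omega\ge0$, $\|f\|_{L^{p_0}(\mathbb{R}^n\times\mathbb{R}^m,\omega)}=(\int|f(z)|^{p_0}\omega(z)\,dz)^{1/p_0}$. For $x\in\mathbb{R}^d$, $r>0$, $Q(x,r)$ is the cube centered at $x$ with side length $r$; $\mathcal{R}$ is the set of all $Q(x,r)\times Q(y,s)$, $x\in\mathbb{R}^n$, $y\in\mathbb{R}^m$, $r,s>0$. The strong maximal operator is $M_Sf(z)=\sup_{z\in R\in\mathcal{R}}\frac1{|R|}\int_R|f(z')|\,dz'$. For $k\in\mathbb{Z}$, $Q_k=Q(0,2^k)$ (in $\mathbb{R}^n$ or $\mathbb{R}^m$); $R_{i,j}=Q_i\times Q_j$; $I_i=Q_i\setminus Q_{i-1}\subset\mathbb{R}^n$, $J_j=Q_j\setminus Q_{j-1}\subset\mathbb{R}^m$; $\chi_{i,j}$ is the characteristic function of $I_i\times J_j$. For $a\in\mathbb{R}$, $0<r,s<\infty$,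 $\mu>0$ and measurable $f$ (norms may be $+\infty$): $$\|f\|_{\vec{\dot K}_{r,s}^{a}}=\Big(\sum_{i,j\in\mathbb{Z}}2^{(i+j)sa}\|f\chi_{i,j}\|_{L^r(\mathbb{R}^n\times\mathbb{R}^m)}^s\Big)^{1/s},\qquad \|f\|_{M\vec{\dot K}_{r,s}^{a,\mu}}=\sup_{L_1,L_2\in\mathbb{Z}}2^{-(L_1+L_2)\mu}\|f\chi_{R_{L_1,L_2}}\|_{\vec{\dot K}_{r,s}^{a}}.$$ The product Morrey-Herz space $M\vec{\dot K}_{r,s}^{a,\mu}$ consists of all $f\in L^r_{\mathrm{loc}}((\mathbb{R}^n\setminus\{0\})\times(\mathbb{R}^m\setminus\{0\}))$ with $\|f\|_{M\vec{\dot K}_{r,s}^{a,\mu}}<\infty$. A measurable $b$ is a product Herz-block, $b\in b\vec{\dot K}_{r,s}^{a,\mu}$, if it is supported in some $R_{l_1,l_2}$, $l_1,l_2\in\mathbb{Z}$, and $\|b\|_{\vec{\dot K}_{r,s}^{a}}\le2^{-\mu(l_1+l_2)}$. The product block-Herz space $B\vec{\dot K}_{r,s}^{a,\mu}$ is the set of all $\sum_{k=1}^\infty\lambda_kb_k$ with $\sum_k|\lambda_k|<\infty$, $b_k\in b\vec{\dot K}_{r,s}^{a,\mu}$ (for $r,s\ge1$ such series converge absolutely a.e.), with norm the infimum of $\sum_k|\lambda_k|$ over all such representations. Under the stated assumptions on the parameters $M_S$ is bounded on $X$; $\|M_S\|_X$ is its operator norm. The Rubio de Francia operator on $X$ is $$\mathfrak{R}h=\sum_{k=0}^\infty\frac{M_S^k(|h|)}{2^k\|M_S\|_X^k},$$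 where $M_S^0$ is the identity and $M_S^k$ is the $k$-th iterate of $M_S$. *)

theory Defs
  imports "HOL-Analysis.Analysis"
begin

text \<open>
  The functions are complex-valued, and measurable means Lebesgue measurable. All (quasi-)norms take
  values in \<^typ>\<open>ennreal\<close>. Those that depend only on the modulus are defined for
  \<^typ>\<open>ennreal\<close>-valued functions, so that they also apply to maximal functions and to infinite
  sums of powers, which may be infinite at some points.
\<close>

definition modulus :: "('a \<Rightarrow> complex) \<Rightarrow> 'a \<Rightarrow> ennreal" where
  "modulus f = (\<lambda>z. ennreal (norm (f z)))"

text \<open>Real powers on \<open>[0, \<infinity>]\<close>, meant for exponents \<open>a > 0\<close>.\<close>

definition epowr :: "ennreal \<Rightarrow> real \<Rightarrow> ennreal" (infixr "epowr" 80) where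
  "x epowr a = (if x = \<infinity> then \<infinity> else ennreal (enn2real x powr a))"

definition conj_exponent :: "real \<Rightarrow> real" where
  "conj_exponent r = r / (r - 1)"

definition Lp_norm :: "real \<Rightarrow> ('a::euclidean_space \<Rightarrow> ennreal) \<Rightarrow> ('a \<Rightarrow> ennreal) \<Rightarrow> ennreal" where
  "Lp_norm p \<omega> F = (\<integral>\<^sup>+ z. F z epowr p * \<omega> z \<partial>lebesgue) epowr (1 / p)"

definition Lp_space :: "real \<Rightarrow> ('a::euclidean_space \<Rightarrow> ennreal) \<Rightarrow> ('a \<Rightarrow> complex) set" where
  "Lp_space p \<omega> = {f \<in> borel_measurable lebesgue. Lp_norm p \<omega> (modulus f) < \<infinity>}"

text \<open>Cubes are open here; the choice only affects boundaries, which are null sets, and does not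
  change the maximal function.\<close>

definition cube :: "real ^ 'd \<Rightarrow> real \<Rightarrow> (real ^ 'd) set" where
  "cube x r = {y. \<forall>i. \<bar>y $ i - x $ i\<bar> < r / 2}"

definition rectangles :: "((real ^ 'n) \<times> (real ^ 'm)) set set" where
  "rectangles = {cube x r \<times> cube y s | x y r s. 0 < r \<and> 0 < s}"

definition strong_maximal ::
  "((real ^ 'n) \<times> (real ^ 'm) \<Rightarrow> ennreal) \<Rightarrow> (real ^ 'n) \<times> (real ^ 'm) \<Rightarrow> ennreal" where
  "strong_maximal F z =
     (SUP R \<in> {R \<in> rectangles. z \<in> R}. (\<integral>\<^sup>+ w\<in>R. F w \<partial>lebesgue) / emeasure lebesgue R)"

definition dyadic_cube :: "int \<Rightarrow> (real ^ 'd) set" where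
  "dyadic_cube k = cube 0 (2 powi k)"

definition dyadic_rect :: "int \<Rightarrow> int \<Rightarrow> ((real ^ 'n) \<times> (real ^ 'm)) set" where
  "dyadic_rect i j = dyadic_cube i \<times> dyadic_cube j"

definition annulus :: "int \<Rightarrow> (real ^ 'd) set" where
  "annulus k = dyadic_cube k - dyadic_cube (k - 1)"

definition herz_norm ::
  "real \<Rightarrow> real \<Rightarrow> real \<Rightarrow> ((real ^ 'n) \<times> (real ^ 'm) \<Rightarrow> ennreal) \<Rightarrow> ennreal" where
  "herz_norm r s a F =
     (\<integral>\<^sup>+ (i, j). ennreal (2 powr (real_of_int (i + j) * s * a)) *
        (Lp_norm r (\<lambda>_. 1) (\<lambda>z. F z * indicator (annulus i \<times> annulus j) z)) epowr s
      \<partial>count_space (UNIV :: (int \<times> int) set)) epowr (1 / s)"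

definition morrey_herz_norm ::
  "real \<Rightarrow> real \<Rightarrow> real \<Rightarrow> real \<Rightarrow> ((real ^ 'n) \<times> (real ^ 'm) \<Rightarrow> ennreal) \<Rightarrow> ennreal" where
  "morrey_herz_norm r s a \<mu> F =
     (SUP (L1, L2) \<in> (UNIV :: (int \<times> int) set).
        ennreal (2 powr (- real_of_int (L1 + L2) * \<mu>)) *
        herz_norm r s a (\<lambda>z. F z * indicator (dyadic_rect L1 L2) z))"

definition Lp_loc :: "real \<Rightarrow> 'a::euclidean_space set \<Rightarrow> ('a \<Rightarrow> complex) set" where
  "Lp_loc r U = {f \<in> borel_measurable lebesgue.
     \<forall>K. compact K \<and> K \<subseteq> U \<longrightarrow> (\<integral>\<^sup>+ z\<in>K. modulus f z epowr r \<partial>lebesgue) < \<infinity>}"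

definition morrey_herz_space ::
  "real \<Rightarrow> real \<Rightarrow> real \<Rightarrow> real \<Rightarrow> ((real ^ 'n) \<times> (real ^ 'm) \<Rightarrow> complex) set" where
  "morrey_herz_space r s a \<mu> =
     {f \<in> Lp_loc r ((UNIV - {0}) \<times> (UNIV - {0})). morrey_herz_norm r s a \<mu> (modulus f) < \<infinity>}"

definition herz_block ::
  "real \<Rightarrow> real \<Rightarrow> real \<Rightarrow> real \<Rightarrow> ((real ^ 'n) \<times> (real ^ 'm) \<Rightarrow> complex) \<Rightarrow> bool" where
  "herz_block r s a \<mu> b \<longleftrightarrow> b \<in> borel_measurable lebesgue \<and>
     (\<exists>l1 l2 :: int. (AE z in lebesgue. z \<notin> dyadic_rect l1 l2 \<longrightarrow> b z = 0) \<and>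
        herz_norm r s a (modulus b) \<le> ennreal (2 powr (- \<mu> * real_of_int (l1 + l2))))"

definition block_repr ::
  "real \<Rightarrow> real \<Rightarrow> real \<Rightarrow> real \<Rightarrow> (nat \<Rightarrow> complex) \<Rightarrow>
   (nat \<Rightarrow> (real ^ 'n) \<times> (real ^ 'm) \<Rightarrow> complex) \<Rightarrow> ((real ^ 'n) \<times> (real ^ 'm) \<Rightarrow> complex) \<Rightarrow> bool" where
  "block_repr r s a \<mu> c b h \<longleftrightarrow>
     summable (\<lambda>k. norm (c k)) \<and> (\<forall>k. herz_block r s a \<mu> (b k)) \<and>
     (AE z in lebesgue. (\<lambda>k. c k * b k z) sums h z)"

definition block_herz_space ::
  "real \<Rightarrow> real \<Rightarrow> real \<Rightarrow> real \<Rightarrow> ((real ^ 'n) \<times> (real ^ 'm) \<Rightarrow> complex) set" where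
  "block_herz_space r s a \<mu> = {h. \<exists>c b. block_repr r s a \<mu> c b h}"

text \<open>The infimum of the empty set is \<open>\<infinity>\<close>, so this norm is infinite exactly off the space.\<close>

definition block_herz_norm ::
  "real \<Rightarrow> real \<Rightarrow> real \<Rightarrow> real \<Rightarrow> ((real ^ 'n) \<times> (real ^ 'm) \<Rightarrow> complex) \<Rightarrow> ennreal" where
  "block_herz_norm r s a \<mu> h = Inf {ennreal (\<Sum>k. norm (c k)) | c b. block_repr r s a \<mu> c b h}"

text \<open>A Banach space \<open>X\<close> of functions is given by its norm \<open>N\<close>, with value \<open>\<infinity>\<close> off \<open>X\<close>. The norm is
  extended to \<open>[0, \<infinity>]\<close>-valued functions: such a function belongs to \<open>X\<close> only if it is finite almost
  everywhere, and is then identified with a complex function.\<close>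

definition norm_ext :: "(('a::euclidean_space \<Rightarrow> complex) \<Rightarrow> ennreal) \<Rightarrow> ('a \<Rightarrow> ennreal) \<Rightarrow> ennreal" where
  "norm_ext N F = (if AE z in lebesgue. F z < \<infinity> then N (\<lambda>z. complex_of_real (enn2real (F z))) else \<infinity>)"

definition strong_maximal_opnorm ::
  "(((real ^ 'n) \<times> (real ^ 'm) \<Rightarrow> complex) \<Rightarrow> ennreal) \<Rightarrow> ennreal" where
  "strong_maximal_opnorm N = (SUP h \<in> {h. N h \<le> 1}. norm_ext N (strong_maximal (modulus h)))"

definition rubio_de_francia ::
  "(((real ^ 'n) \<times> (real ^ 'm) \<Rightarrow> complex) \<Rightarrow> ennreal) \<Rightarrow>
   ((real ^ 'n) \<times> (real ^ 'm) \<Rightarrow> complex) \<Rightarrow> (real ^ 'n) \<times> (real ^ 'm) \<Rightarrow> ennreal" where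
  "rubio_de_francia N h z =
     (\<Sum>k. (strong_maximal ^^ k) (modulus h) z / (2 ^ k * strong_maximal_opnorm N ^ k))"

end

theory Submission
  imports Defs
begin

text \<open>
  The proof is a duality argument. Hoelder's inequality, applied on each product of annuli and then
  to the sum over the annuli, gives \<open>\<integral> F \<bar>h\<bar> \<le> \<parallel>F\<parallel> \<parallel>h\<parallel>\<close> for the Morrey-Herz norm of \<open>F\<close> and the block norm
  of \<open>h\<close>. Conversely, the extremal functions for Hoelder's inequality, truncated so that all
  quantities are finite, are multiples of blocks, so that the Morrey-Herz norm of \<open>G\<close> is the supremum
  of \<open>\<integral> G \<bar>b\<bar>\<close> over all blocks \<open>b\<close>. For \<open>G = \<bar>T f\<bar>\<^sup>p\<close> with \<open>p = p\<^sub>0\<close>, replace \<open>\<bar>b\<bar>\<close> by its majorant \<open>R b\<close>,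
  apply the weighted bound, and estimate \<open>\<integral> \<bar>f\<bar>\<^sup>p R b\<close> by Hoelder's inequality term by term in the
  series of \<open>R b\<close>; the terms decay like \<open>2\<^sup>-\<^sup>k\<close>.
\<close>

subsection \<open>Powers and Hoelder's inequality in the extended nonnegative reals\<close>

text \<open>The bound on T concerns p_0-th powers, and F -> F^(1/p_0) relates the Morrey-Herz norm
  with exponents p, q to the one with p/p_0, q/p_0 > 1; duality is used only after this rescaling.
  The weighted bound for p_0-th powers is an inequality between integrals, so it can be summed over
  a sequence: the scalar and the vector-valued estimate are instances of one statement about a pair
  F, G, with the common constant (2 C^p_0)^(1/p_0). Two obstacles shape the details. Iterates of the
  maximal operator are suprema over uncountable families; they are handled through functions of X
  that agree with them almost everywhere, and these are measurable as almost everywhere limits of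
  series of blocks. Moreover, R b divides by powers of an operator norm with values in
  [0, \<infinity>]: the value \<infinity> leaves only the first term, and the value 0 is excluded by
  a test block. Finally, T is controlled only for nonzero h, so the duality is arranged to test with
  nonzero blocks.\<close>

lemma epowr_0 [simp]: "0 epowr a = 0"
  by (simp add: epowr_def)

lemma epowr_top [simp]: "\<infinity> epowr a = \<infinity>" "top epowr a = top"
  by (simp_all add: epowr_def)

lemma epowr_one [simp]: "1 epowr a = 1"
  by (simp add: epowr_def)

lemma epowr_one_right [simp]: "x epowr 1 = x"
  by (cases x) (auto simp: epowr_def)

lemma epowr_ennreal: "0 \<le> x \<Longrightarrow> ennreal x epowr a = ennreal (x powr a)"
  by (simp add: epowr_def)

lemma epowr_eq_0_iff [simp]: "x epowr a = 0 \<longleftrightarrow> x = 0"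
  by (cases x) (auto simp: epowr_def)

lemma epowr_less_top_iff [simp]: "x epowr a < \<infinity> \<longleftrightarrow> x < \<infinity>" "x epowr a < top \<longleftrightarrow> x < top"
  by (cases x; auto simp: epowr_def)+

lemma epowr_epowr: "(x epowr a) epowr b = x epowr (a * b)"
  by (cases x) (auto simp: epowr_ennreal powr_powr)

text \<open>A power vanishes only at 0, whatever the exponent, so the convention 0 * top = 0 gives
  the same value on both sides in the mixed cases.\<close>

lemma epowr_mult: "(x * y) epowr a = x epowr a * y epowr a"
proof -
  have "x epowr a \<noteq> 0" if "x \<noteq> 0" for x :: ennreal
    using that by simp
  then show ?thesis
    by (cases x; cases y)
      (auto simp: epowr_ennreal powr_mult ennreal_mult_eq_top_iff ennreal_top_mult ennreal_mult_top
        simp flip: ennreal_mult)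
qed

lemma epowr_mono: "x \<le> y \<Longrightarrow> 0 \<le> a \<Longrightarrow> x epowr a \<le> y epowr a"
  by (cases x; cases y) (auto simp: epowr_ennreal powr_mono2 top_unique)

text \<open>The powers with exponents a and 1 / a are monotone and inverse to each other, hence form
  a Galois connection. This is what makes powers commute with suprema.\<close>

lemma epowr_le_iff: "0 < a \<Longrightarrow> x epowr a \<le> y \<longleftrightarrow> x \<le> y epowr (1 / a)"
  using epowr_mono[of "x epowr a" y "1 / a"] epowr_mono[of x "y epowr (1 / a)" a]
  by (auto simp: epowr_epowr)

lemma epowr_SUP:
  assumes "0 < a"
  shows "(SUP i\<in>I. f i) epowr a = (SUP i\<in>I. f i epowr a)"
proof (rule antisym)
  show "(SUP i\<in>I. f i) epowr a \<le> (SUP i\<in>I. f i epowr a)"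
    unfolding epowr_le_iff[OF assms]
    by (rule SUP_least) (auto simp: assms intro!: SUP_upper simp flip: epowr_le_iff)
qed (auto intro!: SUP_least epowr_mono SUP_upper simp: assms less_imp_le)

lemma measurable_epowr [measurable (raw)]:
  assumes [measurable]: "f \<in> borel_measurable M"
  shows "(\<lambda>x. f x epowr a) \<in> borel_measurable M"
  unfolding epowr_def by measurable

lemma epowr_indicator: "(x * indicator A z) epowr a = x epowr a * indicator A z"
  by (simp split: split_indicator)

section \<open>Young's and Hoelder's inequalities with values in [0, \<infinity>]\<close>

lemma Youngs_inequality_ennreal:
  fixes x y :: ennreal
  assumes "p > 1" "q > 1" "1 / p + 1 / q = 1"
  shows "x * y \<le> ennreal (1 / p) * x epowr p + ennreal (1 / q) * y epowr q"
proof (cases "x = top \<or> y = top")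
  case True
  then show ?thesis
    using assms by (auto simp: ennreal_mult_top)
next
  case False
  then obtain a b where ab: "x = ennreal a" "0 \<le> a" "y = ennreal b" "0 \<le> b"
    by (cases x; cases y) auto
  then have "a * b \<le> a powr p / p + b powr q / q"
    using assms by (intro Youngs_inequality)
  then show ?thesis
    using assms ab by (simp add: epowr_ennreal flip: ennreal_mult ennreal_plus)
qed

text \<open>Divide f and g by their norms and integrate Young's inequality; the right-hand side
  becomes 1 / p + 1 / q = 1. If one norm is 0, then the product vanishes almost everywhere, in
  accordance with 0 * top = 0; if one is infinite and none is 0, the bound is top.\<close>

lemma nn_integral_Holder:
  fixes f g :: "'a \<Rightarrow> ennreal"
  assumes pq: "p > 1" "q > 1" "1 / p + 1 / q = 1"
    and [measurable]: "f \<in> borel_measurable M" "g \<in> borel_measurable M"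
  shows "(\<integral>\<^sup>+x. f x * g x \<partial>M) \<le>
    (\<integral>\<^sup>+x. f x epowr p \<partial>M) epowr (1 / p) * (\<integral>\<^sup>+x. g x epowr q \<partial>M) epowr (1 / q)"
    (is "?I \<le> ?A epowr _ * ?B epowr _")
proof -
  consider "?A = 0 \<or> ?B = 0" | "?A \<noteq> 0" "?B \<noteq> 0" "?A = top \<or> ?B = top" | "?A \<noteq> 0" "?B \<noteq> 0" "?A < top" "?B < top"
    using less_top by blast
  then show ?thesis
  proof cases
    case 1
    then have "(AE x in M. f x = 0) \<or> (AE x in M. g x = 0)"
      by (simp add: nn_integral_0_iff_AE)
    then have "AE x in M. f x * g x = 0"
      by auto
    then have "?I = 0"
      by (simp add: nn_integral_0_iff_AE)
    then show ?thesis by simp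
  next
    case 2
    then show ?thesis by (auto simp: ennreal_mult_top ennreal_top_mult)
  next
    case 3
    define a b where "a = enn2real ?A powr (1 / p)" and "b = enn2real ?B powr (1 / q)"
    have AB: "?A epowr (1 / p) = ennreal a" "?B epowr (1 / q) = ennreal b"
      using 3 by (auto simp: a_def b_def epowr_def)
    have pos: "0 < enn2real ?A" "0 < enn2real ?B"
      using 3 unfolding enn2real_positive_iff zero_less_iff_neq_zero by auto
    then have "a > 0" "b > 0"
      by (simp_all add: a_def b_def)
    have A: "?A = ennreal (a powr p)" "?B = ennreal (b powr q)"
      using 3 pq pos by (simp_all add: a_def b_def powr_powr)
    have "ennreal (1 / (a * b)) = ennreal (1 / a) * ennreal (1 / b)"
      using \<open>a > 0\<close> \<open>b > 0\<close> by (simp flip: ennreal_mult)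
    then have "ennreal (1 / (a * b)) * ?I = (\<integral>\<^sup>+x. (ennreal (1 / a) * f x) * (ennreal (1 / b) * g x) \<partial>M)"
      by (simp add: nn_integral_cmult[symmetric] mult_ac)
    also have "\<dots> \<le> (\<integral>\<^sup>+x. ennreal (1 / p) * (ennreal (1 / a) * f x) epowr p
        + ennreal (1 / q) * (ennreal (1 / b) * g x) epowr q \<partial>M)"
      by (intro nn_integral_mono Youngs_inequality_ennreal pq)
    also have "\<dots> = ennreal (1 / p) * (ennreal ((1 / a) powr p) * ?A)
        + ennreal (1 / q) * (ennreal ((1 / b) powr q) * ?B)"
      using \<open>a > 0\<close> \<open>b > 0\<close> by (simp add: epowr_mult nn_integral_add nn_integral_cmult epowr_ennreal)
    also have "\<dots> = 1"
      unfolding A using \<open>a > 0\<close> \<open>b > 0\<close> pq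
      by (simp add: powr_divide flip: ennreal_mult ennreal_plus)
    finally have "ennreal (a * b) * (ennreal (1 / (a * b)) * ?I) \<le> ennreal (a * b) * 1"
      by (rule mult_left_mono) simp
    moreover have "ennreal (a * b) * ennreal (1 / (a * b)) = 1"
      using \<open>a > 0\<close> \<open>b > 0\<close> by (simp flip: ennreal_mult)
    ultimately show ?thesis
      unfolding AB using \<open>a > 0\<close> \<open>b > 0\<close> by (simp add: mult.assoc[symmetric] ennreal_mult)
  qed
qed

subsection \<open>The dyadic decomposition\<close>

text \<open>The pair (i, j) is kept as one index, so that the double sum of the Herz norm is a
  single integral over a counting measure.\<close>

definition cell :: "int \<times> int \<Rightarrow> ((real ^ 'n) \<times> (real ^ 'm)) set" where
  "cell ij = annulus (fst ij) \<times> annulus (snd ij)"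

definition weight :: "real \<Rightarrow> int \<times> int \<Rightarrow> real" where
  "weight a ij = 2 powr (real_of_int (fst ij + snd ij) * a)"

lemma open_cube: "open (cube (x :: real ^ 'd) r)"
proof -
  have "cube x r = (\<Inter>i. {y. \<bar>y $ i - x $ i\<bar> < r / 2})"
    by (auto simp: cube_def)
  moreover have "open {y. \<bar>y $ i - x $ i\<bar> < r / 2}" for i
    by (intro open_Collect_less continuous_intros)
  ultimately show ?thesis
    by (simp add: open_INT)
qed

lemma bounded_cube: "bounded (cube (x :: real ^ 'd) r)"
proof (rule bounded_subset[OF bounded_cbox])
  show "cube x r \<subseteq> cbox (\<chi> i. x $ i - r / 2) (\<chi> i. x $ i + r / 2)"
  proof
    fix y assume y: "y \<in> cube x r"
    have "x $ i - r / 2 \<le> y $ i \<and> y $ i \<le> x $ i + r / 2" for i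
    proof -
      have "\<bar>y $ i - x $ i\<bar> < r / 2" using y by (simp add: cube_def)
      then show ?thesis by linarith
    qed
    then show "y \<in> cbox (\<chi> i. x $ i - r / 2) (\<chi> i. x $ i + r / 2)"
      by (simp add: mem_box_cart)
  qed
qed

lemma cube_mono: "r \<le> s \<Longrightarrow> cube 0 r \<subseteq> cube 0 s"
  unfolding cube_def by (auto intro: order.strict_trans2[where b = r])

lemma dyadic_cube_mono: "i \<le> j \<Longrightarrow> dyadic_cube i \<subseteq> dyadic_cube j"
  unfolding dyadic_cube_def by (intro cube_mono power_int_increasing) auto

lemma annulus_disjoint:
  assumes "x \<in> annulus i" "x \<in> annulus j"
  shows "i = j"
proof -
  have *: False if "i < j" "x \<in> annulus i" "x \<in> annulus j" for i j
    using that dyadic_cube_mono[of i "j - 1"] by (auto simp: annulus_def)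
  show ?thesis using *[of i j] *[of j i] assms by (meson linorder_cases)
qed

lemma cell_disjoint: "z \<in> cell ij \<Longrightarrow> z \<in> cell kl \<Longrightarrow> ij = kl"
  unfolding cell_def prod_eq_iff mem_Times_iff by (blast intro: annulus_disjoint)

text \<open>Dyadic cubes are nested, so an annulus lies either inside or outside each of them.
  Truncation to a dyadic rectangle therefore keeps or discards whole cells.\<close>

lemma annulus_subset_iff_dyadic_cube:
  "x \<in> annulus i \<Longrightarrow> x \<in> dyadic_cube k \<longleftrightarrow> i \<le> k"
  using dyadic_cube_mono[of i k] dyadic_cube_mono[of k "i - 1"]
  by (cases "i \<le> k") (auto simp: annulus_def)

lemma cell_dyadic_rect_iff:
  "z \<in> cell ij \<Longrightarrow> z \<in> dyadic_rect k l \<longleftrightarrow> fst ij \<le> k \<and> snd ij \<le> l"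
  by (auto simp: cell_def dyadic_rect_def annulus_subset_iff_dyadic_cube)

lemma open_dyadic_rect: "open (dyadic_rect i j)"
  by (simp add: dyadic_rect_def dyadic_cube_def open_Times open_cube)

lemma bounded_dyadic_rect: "bounded (dyadic_rect i j)"
  by (simp add: dyadic_rect_def dyadic_cube_def bounded_Times bounded_cube)

lemma sets_dyadic_rect [measurable]: "dyadic_rect i j \<in> sets lebesgue"
  using borel_open[OF open_dyadic_rect] by (intro sets_completionI_sets) simp

lemma borel_annulus: "annulus i \<in> sets borel"
  by (simp add: annulus_def dyadic_cube_def open_cube)

lemma sets_cell [measurable]:
  "(cell ij :: ((real ^ 'n) \<times> (real ^ 'm)) set) \<in> sets lebesgue"
proof -
  have "(cell ij :: ((real ^ 'n) \<times> (real ^ 'm)) set) \<in> sets borel"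
    unfolding cell_def borel_prod[symmetric] by (intro pair_measureI borel_annulus)
  then show ?thesis by (intro sets_completionI_sets) simp
qed

lemma cell_subset_dyadic_rect: "cell ij \<subseteq> dyadic_rect (fst ij) (snd ij)"
  by (auto simp: cell_def dyadic_rect_def annulus_def)

lemma emeasure_cell_finite: "emeasure lebesgue (cell ij) < top"
proof -
  have "cell ij \<in> lmeasurable"
    by (intro bounded_set_imp_lmeasurable bounded_subset[OF bounded_dyadic_rect cell_subset_dyadic_rect]) measurable
  then show ?thesis by (auto simp: fmeasurable_def)
qed

lemma ex_annulus:
  fixes x :: "real ^ 'd"
  assumes "x \<noteq> 0"
  shows "\<exists>k. x \<in> annulus k"
proof -
  define M where "M = Max (range (\<lambda>i. \<bar>x $ i\<bar>))"
  have M: "M < c \<longleftrightarrow> (\<forall>i. \<bar>x $ i\<bar> < c)" for c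
    unfolding M_def by (subst Max_less_iff) auto
  from assms obtain i where "x $ i \<noteq> 0" by (auto simp: vec_eq_iff)
  then have "M > 0"
    using M[of "\<bar>x $ i\<bar>"] by (metis less_irrefl not_less_iff_gr_or_eq order.strict_trans zero_less_abs_iff)
  have mem: "x \<in> dyadic_cube k \<longleftrightarrow> 2 * M < 2 powr real_of_int k" for k
    using M[of "2 powi k / 2"] by (auto simp: dyadic_cube_def cube_def powr_real_of_int')
  \<comment> \<open>\<open>M\<close> is the sup norm of x, and k is the least integer with 2 M <
    2^k. The inequality is strict because the cubes are open, hence floor plus one instead of a
    ceiling.\<close>
  define k where "k = \<lfloor>log 2 (2 * M)\<rfloor> + 1"
  have "2 * M < 2 powr real_of_int k" "2 powr real_of_int (k - 1) \<le> 2 * M"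
    using \<open>M > 0\<close> by (simp_all add: k_def less_powr_iff powr_le_iff)
  then have "x \<in> annulus k"
    by (auto simp: annulus_def mem)
  then show ?thesis ..
qed

lemma AE_cell: "AE z in lebesgue. \<exists>ij. z \<in> (cell ij :: ((real ^ 'n) \<times> (real ^ 'm)) set)"
proof -
  \<comment> \<open>A point outside all cells has a zero component in one of the two factors, so it
    lies on one of these two hyperplanes. The index \<open>undefined\<close> stands for an arbitrary
    coordinate.\<close>
  have "negligible ({z :: (real ^ 'n) \<times> (real ^ 'm). (axis undefined 1, 0) \<bullet> z = 0} \<union> {z. (0, axis undefined 1) \<bullet> z = 0})"
    by (intro negligible_Un negligible_hyperplane) (auto simp: zero_prod_def axis_eq_0_iff)
  then have "AE z in lebesgue. z \<notin> {z :: (real ^ 'n) \<times> (real ^ 'm). (axis undefined 1, 0) \<bullet> z = 0} \<union> {z. (0, axis undefined 1) \<bullet> z = 0}"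
    by (intro AE_not_in) (simp add: negligible_iff_null_sets)
  then show ?thesis
  proof (rule AE_mp, intro AE_I2 impI)
    fix z :: "(real ^ 'n) \<times> (real ^ 'm)"
    assume *: "z \<notin> {z. (axis undefined 1, 0) \<bullet> z = 0} \<union> {z. (0, axis undefined 1) \<bullet> z = 0}"
    then have "fst z \<noteq> 0" "snd z \<noteq> 0"
      by (auto simp: inner_prod_def)
    then obtain i j where "fst z \<in> annulus i" "snd z \<in> annulus j"
      using ex_annulus by metis
    then have "z \<in> cell (i, j)" by (simp add: cell_def mem_Times_iff)
    then show "\<exists>ij. z \<in> cell ij" ..
  qed
qed

section \<open>Herz norms written as weighted sums over cells, and their Hoelder inequality\<close>

lemma weight_pos [simp]: "weight a ij > 0"
  by (simp add: weight_def)

lemma weight_powr: "weight a ij powr s = weight (s * a) ij"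
  by (simp add: weight_def powr_powr mult_ac)

lemma weight_uminus: "weight a ij * weight (- a) ij = 1"
  by (simp add: weight_def flip: powr_add)

text \<open>The exponents 1 / r and s are merged into s / r, which leaves one power of one integral
  per cell. All later computations use this form.\<close>

lemma herz_norm_eq:
  "herz_norm r s a F = (\<integral>\<^sup>+ ij. ennreal (weight (s * a) ij) *
     (\<integral>\<^sup>+ z. F z epowr r * indicator (cell ij) z \<partial>lebesgue) epowr (s / r) \<partial>count_space UNIV) epowr (1 / s)"
  unfolding herz_norm_def
  by (intro arg_cong[where f = "\<lambda>x. x epowr (1 / s)"] nn_integral_cong)
    (auto simp: weight_def Lp_norm_def cell_def epowr_epowr epowr_indicator mult_ac)

lemma herz_norm_mono:
  assumes "0 < r" "0 < s" "\<And>z. F z \<le> G z"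
  shows "herz_norm r s a F \<le> herz_norm r s a G"
  unfolding herz_norm_eq using assms
  by (intro epowr_mono nn_integral_mono mult_mono) auto

lemma herz_Holder:
  fixes F H :: "(real ^ 'n) \<times> (real ^ 'm) \<Rightarrow> ennreal"
  assumes r: "r > 1" "r' > 1" "1 / r + 1 / r' = 1"
    and s: "s > 1" "s' > 1" "1 / s + 1 / s' = 1"
    and [measurable]: "F \<in> borel_measurable lebesgue" "H \<in> borel_measurable lebesgue"
  shows "(\<integral>\<^sup>+ z. F z * H z \<partial>lebesgue) \<le> herz_norm r s a F * herz_norm r' s' (- a) H"
proof -
  define u where "u ij = (\<integral>\<^sup>+ z. F z epowr r * indicator (cell ij) z \<partial>lebesgue) epowr (1 / r)" for ij
  define v where "v ij = (\<integral>\<^sup>+ z. H z epowr r' * indicator (cell ij) z \<partial>lebesgue) epowr (1 / r')" for ij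
  \<comment> \<open>The cells cover almost every point, and the sum over cells is at least the term
    of the cell that contains z. Disjointness does not enter this direction.\<close>
  have "(\<integral>\<^sup>+ z. F z * H z \<partial>lebesgue) \<le>
      (\<integral>\<^sup>+ z. (\<integral>\<^sup>+ ij. (F z * indicator (cell ij) z) * (H z * indicator (cell ij) z) \<partial>count_space UNIV) \<partial>lebesgue)"
  proof (rule nn_integral_mono_AE, rule AE_mp[OF AE_cell], intro AE_I2 impI)
    fix z :: "(real ^ 'n) \<times> (real ^ 'm)" assume "\<exists>ij. z \<in> cell ij"
    then obtain ij where "z \<in> cell ij" ..
    then show "F z * H z \<le> (\<integral>\<^sup>+ ij. (F z * indicator (cell ij) z) * (H z * indicator (cell ij) z) \<partial>count_space UNIV)"
      using nn_integral_ge_point[of ij UNIV "\<lambda>ij. (F z * indicator (cell ij) z) * (H z * indicator (cell ij) z)"]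
      by simp
  qed
  also have "\<dots> = (\<integral>\<^sup>+ ij. (\<integral>\<^sup>+ z. (F z * indicator (cell ij) z) * (H z * indicator (cell ij) z) \<partial>lebesgue) \<partial>count_space UNIV)"
    by (intro nn_integral_count_space_nn_integral) auto
  also have "\<dots> \<le> (\<integral>\<^sup>+ ij. u ij * v ij \<partial>count_space UNIV)"
    unfolding u_def v_def epowr_indicator[symmetric]
    by (intro nn_integral_mono nn_integral_Holder r) auto
  \<comment> \<open>The factor 1 = 2^((i+j)a) 2^(-(i+j)a) is inserted before the discrete Hoelder
    inequality; this is why the dual norm carries the exponent -a.\<close>
  also have "\<dots> = (\<integral>\<^sup>+ ij. (ennreal (weight a ij) * u ij) * (ennreal (weight (- a) ij) * v ij) \<partial>count_space UNIV)"
  proof (intro nn_integral_cong)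
    fix ij
    have "ennreal (weight a ij) * ennreal (weight (- a) ij) = 1"
      by (simp add: weight_uminus less_imp_le flip: ennreal_mult)
    then show "u ij * v ij = (ennreal (weight a ij) * u ij) * (ennreal (weight (- a) ij) * v ij)"
      by (metis (no_types, lifting) mult.assoc mult.commute mult_1)
  qed
  also have "\<dots> \<le> (\<integral>\<^sup>+ ij. (ennreal (weight a ij) * u ij) epowr s \<partial>count_space UNIV) epowr (1 / s) *
      (\<integral>\<^sup>+ ij. (ennreal (weight (- a) ij) * v ij) epowr s' \<partial>count_space UNIV) epowr (1 / s')"
    by (intro nn_integral_Holder s) auto
  also have "\<dots> = herz_norm r s a F * herz_norm r' s' (- a) H"
    by (simp add: herz_norm_eq u_def v_def epowr_mult epowr_epowr epowr_ennreal less_imp_le weight_powr)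
  finally show ?thesis .
qed

subsection \<open>Duality of Herz norms\<close>

text \<open>Monotone convergence is applied twice, to the integral over each cell and to the sum
  over cells; the powers in between commute with suprema.\<close>

lemma herz_norm_SUP:
  fixes F :: "nat \<Rightarrow> (real ^ 'n) \<times> (real ^ 'm) \<Rightarrow> ennreal"
  assumes "0 < r" "0 < s" and [measurable]: "\<And>k. F k \<in> borel_measurable lebesgue" and "incseq F"
  shows "herz_norm r s a (\<lambda>z. SUP k. F k z) = (SUP k. herz_norm r s a (F k))"
proof -
  define J where "J k ij = (\<integral>\<^sup>+ z. F k z epowr r * indicator (cell ij) z \<partial>lebesgue)" for k ij
  have F: "F k z \<le> F l z" if "k \<le> l" for k l z
    using \<open>incseq F\<close> that unfolding incseq_def le_fun_def by blast
  have J_mono: "J k ij \<le> J l ij" if "k \<le> l" for k l ij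
    unfolding J_def using that \<open>0 < r\<close> by (intro nn_integral_mono mult_right_mono epowr_mono F) auto
  have J: "(\<integral>\<^sup>+ z. (SUP k. F k z) epowr r * indicator (cell ij) z \<partial>lebesgue) = (SUP k. J k ij)" for ij
    unfolding J_def
  proof (subst nn_integral_monotone_convergence_SUP[symmetric])
    show "incseq (\<lambda>k z. F k z epowr r * indicator (cell ij) z)"
      unfolding incseq_def le_fun_def using \<open>0 < r\<close> by (auto intro!: mult_right_mono epowr_mono F)
  qed (simp_all add: epowr_SUP \<open>0 < r\<close> SUP_mult_right_ennreal)
  have "(\<integral>\<^sup>+ ij. (SUP k. ennreal (weight (s * a) ij) * J k ij epowr (s / r)) \<partial>count_space UNIV) =
      (SUP k. \<integral>\<^sup>+ ij. ennreal (weight (s * a) ij) * J k ij epowr (s / r) \<partial>count_space UNIV)"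
    using assms(1,2)
    by (intro nn_integral_monotone_convergence_SUP)
      (auto simp: incseq_def le_fun_def intro!: mult_left_mono epowr_mono J_mono)
  then show ?thesis
    unfolding herz_norm_eq J using assms(1,2) by (simp add: epowr_SUP SUP_mult_left_ennreal J_def)
qed

text \<open>The function b is chosen so that equality holds in both Hoelder inequalities: it is a
  multiple of g^(r-1) on each cell, and its weighted cell norms are proportional to the (s-1)-th
  powers of those of g. Since g is bounded and lives on finitely many cells, all quantities are real
  numbers.\<close>

lemma herz_dual:
  fixes g :: "(real ^ 'n) \<times> (real ^ 'm) \<Rightarrow> real"
  assumes r: "r > 1" "r' > 1" "1 / r + 1 / r' = 1"
    and s: "s > 1" "s' > 1" "1 / s + 1 / s' = 1"
    and g [measurable]: "g \<in> borel_measurable lebesgue" and g0: "\<And>z. 0 \<le> g z" and gK: "\<And>z. g z \<le> K"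
    and S: "finite S" "\<And>z. g z \<noteq> 0 \<Longrightarrow> \<exists>ij\<in>S. z \<in> cell ij"
    and nz: "herz_norm r s a (\<lambda>z. ennreal (g z)) \<noteq> 0"
  shows "\<exists>b \<in> borel_measurable lebesgue. (\<forall>z. 0 \<le> b z) \<and> (\<forall>z. g z = 0 \<longrightarrow> b z = 0) \<and>
    herz_norm r' s' (- a) (\<lambda>z. ennreal (b z)) \<le> 1 \<and>
    (\<integral>\<^sup>+ z. ennreal (g z) * ennreal (b z) \<partial>lebesgue) = herz_norm r s a (\<lambda>z. ennreal (g z))"
proof -
  define I where "I ij = enn2real (\<integral>\<^sup>+ z. ennreal (g z) epowr r * indicator (cell ij) z \<partial>lebesgue)" for ij
  define A where "A = (\<Sum>ij\<in>S. weight (s * a) ij * I ij powr (s / r))"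
  \<comment> \<open>The power of \<open>I ij\<close> brings the cell norm of b to the required size,
    and the division by A^(1/s') normalizes b. The exponent (s - r) / r may be negative;
    \<open>powr\<close> gives 0 at base 0, so a cell with \<open>I ij = 0\<close> simply gets the
    coefficient 0.\<close>
  define c where "c ij = weight (s * a) ij * I ij powr ((s - r) / r) / A powr (1 / s')" for ij
  define b where "b z = (\<Sum>ij\<in>S. c ij * indicator (cell ij) z) * g z powr (r - 1)" for z
  have [simp]: "I ij \<ge> 0" for ij by (simp add: I_def)
  have "A \<ge> 0" unfolding A_def by (intro sum_nonneg) (simp add: less_imp_le)
  have [simp]: "c ij \<ge> 0" for ij by (simp add: c_def less_imp_le)
  have gr: "ennreal (g z) epowr r = ennreal (g z powr r)" for z
    by (simp add: epowr_ennreal g0)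
  have I: "(\<integral>\<^sup>+ z. ennreal (g z powr r) * indicator (cell ij) z \<partial>lebesgue) = ennreal (I ij)" for ij
  proof -
    have "(\<integral>\<^sup>+ z. ennreal (g z powr r) * indicator (cell ij) z \<partial>lebesgue)
        \<le> (\<integral>\<^sup>+ z. ennreal (K powr r) * indicator (cell ij :: ((real ^ 'n) \<times> (real ^ 'm)) set) z \<partial>lebesgue)"
      using r g0 gK by (intro nn_integral_mono mult_right_mono ennreal_leI powr_mono2) auto
    also have "\<dots> < top"
      by (simp add: nn_integral_cmult_indicator ennreal_mult_less_top emeasure_cell_finite del: emeasure_completion)
    finally show ?thesis by (simp add: I_def gr)
  qed
  have I0: "I ij = 0" if "ij \<notin> S" for ij
  proof -
    have *: "ennreal (g z) epowr r * indicator (cell ij) z = 0" for z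
    proof (cases "g z = 0")
      case False
      then show ?thesis using S(2)[of z] that by (auto simp: indicator_def dest: cell_disjoint)
    qed simp
    show ?thesis unfolding I_def * by simp
  qed
  have norm_g: "herz_norm r s a (\<lambda>z. ennreal (g z)) = ennreal (A powr (1 / s))"
  proof -
    have "(\<integral>\<^sup>+ ij. ennreal (weight (s * a) ij) * ennreal (I ij) epowr (s / r) \<partial>count_space UNIV)
        = (\<Sum>ij\<in>S. ennreal (weight (s * a) ij) * ennreal (I ij) epowr (s / r))"
      using S(1) by (intro nn_integral_count_space') (auto simp: I0)
    also have "\<dots> = ennreal A"
      unfolding A_def by (subst sum_ennreal[symmetric]) (auto simp: epowr_ennreal less_imp_le ennreal_mult)
    finally show ?thesis
      unfolding herz_norm_eq gr I using \<open>A \<ge> 0\<close> by (simp add: epowr_ennreal)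
  qed
  with nz have "A > 0"
    using \<open>A \<ge> 0\<close> by (cases "A = 0") auto
  have b_cell: "b z = c ij * g z powr (r - 1)" if "z \<in> cell ij" "ij \<in> S" for z ij
  proof -
    have "(\<Sum>kl\<in>S. c kl * indicator (cell kl) z) = (\<Sum>kl\<in>S. if kl = ij then c ij else 0)"
      using that by (intro sum.cong refl) (auto simp: indicator_def dest: cell_disjoint)
    then show ?thesis using that S(1) by (simp add: b_def)
  qed
  have b0: "b z \<ge> 0" for z
    unfolding b_def by (intro mult_nonneg_nonneg sum_nonneg) auto
  have bg: "b z = 0" if "g z = 0" for z
    using that by (simp add: b_def)
  have gb: "ennreal (g z) * ennreal (b z) =
      (\<Sum>ij\<in>S. ennreal (c ij) * (ennreal (g z powr r) * indicator (cell ij) z))" for z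
  proof -
    have *: "g z powr r = g z * g z powr (r - 1)"
      using g0[of z] r by (cases "g z = 0") (auto simp: powr_mult_base)
    have "g z * b z = (\<Sum>ij\<in>S. c ij * (g z powr r * indicator (cell ij) z))"
      unfolding * by (simp add: b_def sum_distrib_left sum_distrib_right mult_ac)
    then have "ennreal (g z) * ennreal (b z) = ennreal (\<Sum>ij\<in>S. c ij * (g z powr r * indicator (cell ij) z))"
      using g0 b0 by (simp flip: ennreal_mult)
    also have "\<dots> = (\<Sum>ij\<in>S. ennreal (c ij) * (ennreal (g z powr r) * indicator (cell ij) z))"
      by (subst sum_ennreal[symmetric]) (auto simp: ennreal_mult intro!: sum.cong split: split_indicator)
    finally show ?thesis .
  qed
  have int_gb: "(\<integral>\<^sup>+ z. ennreal (g z) * ennreal (b z) \<partial>lebesgue) = ennreal (A powr (1 / s))"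
  proof -
    have "(\<integral>\<^sup>+ z. ennreal (g z) * ennreal (b z) \<partial>lebesgue) = (\<Sum>ij\<in>S. ennreal (c ij) * ennreal (I ij))"
      unfolding gb by (subst nn_integral_sum) (auto simp: nn_integral_cmult I)
    also have "\<dots> = ennreal (\<Sum>ij\<in>S. c ij * I ij)"
      by (subst sum_ennreal[symmetric]) (auto simp: ennreal_mult)
    \<comment> \<open>Multiplication by \<open>I ij\<close> turns the coefficient into the
      corresponding term of \<open>A\<close>, so the pairing is A / A^(1/s') = A^(1/s), the norm of
      g.\<close>
    also have "(\<Sum>ij\<in>S. c ij * I ij) = A / A powr (1 / s')"
    proof -
      have "I ij powr ((s - r) / r) * I ij = I ij powr (s / r)" for ij
        using r by (cases "I ij = 0") (auto simp: powr_mult_base mult.commute[of _ "I ij"] field_simps)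
      then show ?thesis
        unfolding A_def c_def sum_divide_distrib by (intro sum.cong refl) (simp add: mult.assoc)
    qed
    also have "A / A powr (1 / s') = A powr (1 - 1 / s')"
      using \<open>A > 0\<close> by (simp add: powr_diff)
    also have "1 - 1 / s' = 1 / s" using s by simp
    finally show ?thesis .
  qed
  have norm_b: "herz_norm r' s' (- a) (\<lambda>z. ennreal (b z)) = 1"
  proof -
    have rr': "(r - 1) * r' = r" and ss': "(s - 1) * s' = s"
      using r s by (simp_all add: field_simps)
    have J: "(\<integral>\<^sup>+ z. ennreal (b z) epowr r' * indicator (cell ij) z \<partial>lebesgue) =
        (if ij \<in> S then ennreal (c ij powr r' * I ij) else 0)" for ij
    proof (cases "ij \<in> S")
      case True
      have "(\<integral>\<^sup>+ z. ennreal (b z) epowr r' * indicator (cell ij) z \<partial>lebesgue) =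
          (\<integral>\<^sup>+ z. ennreal (c ij powr r') * (ennreal (g z powr r) * indicator (cell ij) z) \<partial>lebesgue)"
        using True
        by (intro nn_integral_cong)
          (auto simp: b_cell epowr_ennreal epowr_mult powr_powr rr' ennreal_mult split: split_indicator)
      then show ?thesis using True by (simp add: nn_integral_cmult I ennreal_mult)
    next
      case False
      have *: "ennreal (b z) epowr r' * indicator (cell ij) z = 0" for z
      proof (cases "g z = 0")
        case False
        then show ?thesis using S(2)[of z] \<open>ij \<notin> S\<close> by (auto simp: indicator_def dest: cell_disjoint)
      qed (simp add: bg)
      show ?thesis unfolding * using False by simp
    qed
    have "(\<integral>\<^sup>+ ij. ennreal (weight (s' * - a) ij) * (if ij \<in> S then ennreal (c ij powr r' * I ij) else 0) epowr (s' / r')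
        \<partial>count_space UNIV)
      = (\<Sum>ij\<in>S. ennreal (weight (s' * - a) ij) * (if ij \<in> S then ennreal (c ij powr r' * I ij) else 0) epowr (s' / r'))"
      using S(1) by (intro nn_integral_count_space') auto
    \<comment> \<open>By s' (s - 1) = s, the term of each cell in the dual norm is the term of that
      cell in \<open>A\<close>, divided by \<open>A\<close>. The terms therefore add up to
      1.\<close>
    also have "\<dots> = (\<Sum>ij\<in>S. ennreal (weight (s * a) ij * I ij powr (s / r) / A))"
    proof (intro sum.cong refl)
      fix ij assume "ij \<in> S"
      have "weight (s' * - a) ij * (c ij powr r' * I ij) powr (s' / r') =
          weight (s' * - a) ij * (weight (s * a) ij powr s') * (I ij powr (((s - r) / r) * s') * I ij powr (s' / r')) / A"
        using r s \<open>A > 0\<close> by (simp add: c_def powr_mult powr_divide powr_powr less_imp_le)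
      also have "weight (s' * - a) ij * (weight (s * a) ij powr s') = weight (s * a) ij"
      proof -
        have *: "s' * (- a + s * a) = s * a"
          using arg_cong[OF ss', of "\<lambda>x. x * a"] by (simp add: algebra_simps)
        show ?thesis
          unfolding weight_powr unfolding weight_def powr_add[symmetric] distrib_left[symmetric] * ..
      qed
      also have "I ij powr (((s - r) / r) * s') * I ij powr (s' / r') = I ij powr (s / r)"
      proof -
        have "((s - r) / r) * s' + s' / r' = s' * (s / r - 1 + 1 / r')"
          using r(1,2) by (simp add: field_simps)
        also have "\<dots> = s' * (s / r - 1 / r)" using r(3) by simp
        also have "\<dots> = s / r" using ss' r(1) by (simp add: field_simps)
        finally show ?thesis by (simp flip: powr_add)
      qed
      finally show "ennreal (weight (s' * - a) ij) * (if ij \<in> S then ennreal (c ij powr r' * I ij) else 0) epowr (s' / r')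
        = ennreal (weight (s * a) ij * I ij powr (s / r) / A)"
        using \<open>ij \<in> S\<close> by (simp add: epowr_ennreal less_imp_le flip: ennreal_mult)
    qed
    also have "\<dots> = ennreal (\<Sum>ij\<in>S. weight (s * a) ij * I ij powr (s / r) / A)"
      using \<open>A > 0\<close> by (intro sum_ennreal) (simp add: less_imp_le)
    also have "(\<Sum>ij\<in>S. weight (s * a) ij * I ij powr (s / r) / A) = 1"
      using \<open>A > 0\<close> unfolding sum_divide_distrib[symmetric] A_def[symmetric] by simp
    finally show ?thesis
      unfolding herz_norm_eq J by simp
  qed
  have "b \<in> borel_measurable lebesgue"
    unfolding b_def by measurable
  with b0 bg show ?thesis
    unfolding norm_g by (intro bexI[of _ b]) (simp_all add: norm_b int_gb)
qed

subsection \<open>Block spaces\<close>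

text \<open>Points outside the cells do not contribute to any term. It is used for truncations to
  finitely many cells, whose limit is only determined on the cells.\<close>

lemma herz_norm_cong_cell:
  assumes "\<And>z ij. z \<in> cell ij \<Longrightarrow> F z = G z"
  shows "herz_norm r s a F = herz_norm r s a G"
proof -
  have "(\<integral>\<^sup>+ z. F z epowr r * indicator (cell ij) z \<partial>lebesgue) =
      (\<integral>\<^sup>+ z. G z epowr r * indicator (cell ij) z \<partial>lebesgue)" for ij
    using assms by (intro nn_integral_cong) (simp split: split_indicator)
  then show ?thesis
    by (simp add: herz_norm_eq)
qed

lemma borel_measurable_modulus [measurable]:
  "h \<in> borel_measurable M \<Longrightarrow> modulus h \<in> borel_measurable M"
  unfolding modulus_def by measurable

text \<open>Preimages under f and g differ by null sets, and Lebesgue measure is complete.\<close>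

lemma borel_measurable_lebesgue_AE:
  assumes f: "f \<in> borel_measurable lebesgue" and ae: "AE z in lebesgue. f z = g z"
  shows "g \<in> borel_measurable lebesgue"
proof (rule measurableI)
  fix A :: "'b set" assume "A \<in> sets borel"
  then have "f -` A \<inter> space lebesgue \<in> sets lebesgue"
    using f by (rule measurable_sets[rotated])
  then show "g -` A \<inter> space lebesgue \<in> sets lebesgue"
    by (rule completion.in_sets_AE[rotated]) (use ae in \<open>auto elim: eventually_mono\<close>)
qed simp

lemma norm_sums_le_suminf:
  fixes f :: "nat \<Rightarrow> 'a::real_normed_vector"
  assumes "f sums x"
  shows "ennreal (norm x) \<le> (\<Sum>k. ennreal (norm (f k)))"
proof (rule LIMSEQ_le_const2)
  show "(\<lambda>n. ennreal (norm (\<Sum>k<n. f k))) \<longlonglongrightarrow> ennreal (norm x)"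
    using assms unfolding sums_def by (intro tendsto_intros)
  show "\<exists>N. \<forall>n\<ge>N. ennreal (norm (\<Sum>k<n. f k)) \<le> (\<Sum>k. ennreal (norm (f k)))"
  proof (intro exI allI impI)
    fix n
    have "ennreal (norm (\<Sum>k<n. f k)) \<le> ennreal (\<Sum>k<n. norm (f k))"
      by (intro ennreal_leI norm_sum)
    also have "\<dots> = (\<Sum>k<n. ennreal (norm (f k)))" by simp
    also have "\<dots> \<le> (\<Sum>k. ennreal (norm (f k)))"
      by (intro sum_le_suminf) auto
    finally show "ennreal (norm (\<Sum>k<n. f k)) \<le> (\<Sum>k. ennreal (norm (f k)))" .
  qed
qed

text \<open>This is the source of measurability for functions of the block space, in particular for
  those that represent maximal functions: a block series determines h only almost everywhere, which
  suffices by completeness.\<close>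

lemma borel_measurable_block_repr:
  assumes "block_repr r s a \<mu> c b h"
  shows "h \<in> borel_measurable lebesgue"
proof (rule borel_measurable_lebesgue_AE)
  have [measurable]: "b k \<in> borel_measurable lebesgue" for k
    using assms by (auto simp: block_repr_def herz_block_def)
  show "(\<lambda>z. \<Sum>k. c k * b k z) \<in> borel_measurable lebesgue"
    by measurable
  show "AE z in lebesgue. (\<Sum>k. c k * b k z) = h z"
    using assms by (auto simp: block_repr_def sums_iff elim: eventually_mono)
qed

lemma block_herz_normE:
  assumes "block_herz_norm r s a \<mu> h < y"
  obtains c b where "block_repr r s a \<mu> c b h" "ennreal (\<Sum>k. norm (c k)) < y"
  using assms unfolding block_herz_norm_def Inf_less_iff by auto

lemma borel_measurable_block_herz:
  "block_herz_norm r s a \<mu> h < top \<Longrightarrow> h \<in> borel_measurable lebesgue"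
  by (metis block_herz_normE borel_measurable_block_repr)

lemma block_herz_norm_finite_imp_space:
  "block_herz_norm r s a \<mu> h < top \<Longrightarrow> h \<in> block_herz_space r s a \<mu>"
  unfolding block_herz_space_def by (auto elim!: block_herz_normE)

lemma block_herz_norm_le:
  "block_repr r s a \<mu> c b h \<Longrightarrow> block_herz_norm r s a \<mu> h \<le> ennreal (\<Sum>k. norm (c k))"
  unfolding block_herz_norm_def by (auto intro: Inf_lower)

lemma block_herz_norm_cmult_le:
  assumes "0 < c"
  shows "block_herz_norm r s a \<mu> (\<lambda>z. complex_of_real c * h z) \<le> ennreal c * block_herz_norm r s a \<mu> h"
    (is "?N \<le> _")
proof -
  \<comment> \<open>The factor c is moved to the left so that only the plain infimum on the right is
    to be bounded from below. This also covers the infimum of the empty set.\<close>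
  have "ennreal (1 / c) * ?N \<le> block_herz_norm r s a \<mu> h"
    unfolding block_herz_norm_def[of r s a \<mu> h]
  proof (rule Inf_greatest, safe)
    fix d b assume d: "block_repr r s a \<mu> d b h"
    then have "block_repr r s a \<mu> (\<lambda>k. complex_of_real c * d k) b (\<lambda>z. complex_of_real c * h z)"
      by (auto simp: block_repr_def norm_mult mult.assoc intro: summable_mult sums_mult elim: eventually_mono)
    then have "?N \<le> ennreal (\<Sum>k. norm (complex_of_real c * d k))"
      by (rule block_herz_norm_le)
    also have "\<dots> = ennreal (c * (\<Sum>k. norm (d k)))"
      using d assms by (simp add: norm_mult block_repr_def suminf_mult)
    finally have "ennreal (1 / c) * ?N \<le> ennreal (1 / c) * ennreal (c * (\<Sum>k. norm (d k)))"
      by (rule mult_left_mono) simp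
    also have "\<dots> = ennreal (\<Sum>k. norm (d k))"
      using assms by (simp flip: ennreal_mult')
    finally show "ennreal (1 / c) * ?N \<le> ennreal (\<Sum>k. norm (d k))" .
  qed
  then have "ennreal c * (ennreal (1 / c) * ?N) \<le> ennreal c * block_herz_norm r s a \<mu> h"
    by (rule mult_left_mono) simp
  moreover have "ennreal c * ennreal (1 / c) = 1"
    using assms by (simp flip: ennreal_mult')
  ultimately show ?thesis
    by (simp add: mult.assoc[symmetric])
qed

lemma block_herz_norm_block_le_1:
  assumes "herz_block r s a \<mu> b"
  shows "block_herz_norm r s a \<mu> b \<le> 1"
proof -
  define c :: "nat \<Rightarrow> complex" where "c k = (if k = 0 then 1 else 0)" for k
  have "(\<lambda>k. norm (c k)) = (\<lambda>k. if k = 0 then 1 else 0)"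
    by (auto simp: c_def)
  then have c: "(\<lambda>k. norm (c k)) sums 1"
    using sums_single[of 0 "\<lambda>_. 1 :: real"] by simp
  have "(\<lambda>k. c k * b z) sums b z" for z
  proof -
    have "(\<lambda>k. c k * b z) = (\<lambda>k. if k = 0 then b z else 0)"
      by (auto simp: c_def)
    then show ?thesis using sums_single[of 0 "\<lambda>_. b z"] by simp
  qed
  with assms c have "block_repr r s a \<mu> c (\<lambda>_. b) b"
    by (auto simp: block_repr_def sums_iff)
  from block_herz_norm_le[OF this] c show ?thesis
    by (simp add: sums_iff)
qed

section \<open>The pairing of Morrey-Herz functions with blocks\<close>

lemma herz_norm_dyadic_rect_le:
  "herz_norm r s a (\<lambda>z. F z * indicator (dyadic_rect k l) z)
    \<le> ennreal (2 powr (\<mu> * real_of_int (k + l))) * morrey_herz_norm r s a \<mu> F"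
proof -
  let ?H = "herz_norm r s a (\<lambda>z. F z * indicator (dyadic_rect k l) z)"
  have "ennreal (2 powr (- real_of_int (k + l) * \<mu>)) * ?H \<le> morrey_herz_norm r s a \<mu> F"
    unfolding morrey_herz_norm_def by (rule SUP_upper2[of "(k, l)"]) auto
  then have "ennreal (2 powr (\<mu> * real_of_int (k + l))) * (ennreal (2 powr (- real_of_int (k + l) * \<mu>)) * ?H)
      \<le> ennreal (2 powr (\<mu> * real_of_int (k + l))) * morrey_herz_norm r s a \<mu> F"
    by (rule mult_left_mono) simp
  moreover have "ennreal (2 powr (\<mu> * real_of_int (k + l))) * ennreal (2 powr (- real_of_int (k + l) * \<mu>)) = 1"
    by (subst ennreal_mult[symmetric]) (simp_all add: algebra_simps flip: powr_add)
  ultimately show ?thesis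
    by (simp add: mult.assoc[symmetric])
qed

text \<open>The exponents r, s, a belong to the Morrey-Herz side, their duals r', s', -a to the
  block side, and \<mu> is common to both. The main proof takes r = p / p_0, s = q / p_0, a = p_0
  \<alpha>, and p_0 times the Morrey exponent for \<mu>.\<close>

locale herz_duality =
  fixes r r' s s' a \<mu> :: real
  assumes r: "r > 1" "r' > 1" "1 / r + 1 / r' = 1"
    and s: "s > 1" "s' > 1" "1 / s + 1 / s' = 1"
begin

text \<open>On the rectangle that supports the block, the growth 2^(\<mu>(k+l)) allowed by the
  Morrey norm cancels exactly the bound 2^(-\<mu>(k+l)) on the block.\<close>

lemma nn_integral_block_le:
  assumes b: "herz_block r' s' (- a) \<mu> b" and [measurable]: "F \<in> borel_measurable lebesgue"
  shows "(\<integral>\<^sup>+ z. F z * modulus b z \<partial>lebesgue) \<le> morrey_herz_norm r s a \<mu> F"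
proof -
  from b obtain k l where [measurable]: "b \<in> borel_measurable lebesgue"
    and ae: "AE z in lebesgue. z \<notin> dyadic_rect k l \<longrightarrow> b z = 0"
    and le: "herz_norm r' s' (- a) (modulus b) \<le> ennreal (2 powr (- \<mu> * real_of_int (k + l)))"
    by (auto simp: herz_block_def)
  have "(\<integral>\<^sup>+ z. F z * modulus b z \<partial>lebesgue) =
      (\<integral>\<^sup>+ z. (F z * indicator (dyadic_rect k l) z) * modulus b z \<partial>lebesgue)"
    using ae by (intro nn_integral_cong_AE) (auto simp: modulus_def elim!: eventually_mono split: split_indicator)
  also have "\<dots> \<le> herz_norm r s a (\<lambda>z. F z * indicator (dyadic_rect k l) z) * herz_norm r' s' (- a) (modulus b)"
    by (intro herz_Holder r s) measurable
  also have "\<dots> \<le> (ennreal (2 powr (\<mu> * real_of_int (k + l))) * morrey_herz_norm r s a \<mu> F) *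
      ennreal (2 powr (- \<mu> * real_of_int (k + l)))"
    by (intro mult_mono herz_norm_dyadic_rect_le le) auto
  also have "\<dots> = (ennreal (2 powr (\<mu> * real_of_int (k + l))) * ennreal (2 powr (- \<mu> * real_of_int (k + l)))) *
      morrey_herz_norm r s a \<mu> F"
    by (simp only: mult_ac)
  also have "ennreal (2 powr (\<mu> * real_of_int (k + l))) * ennreal (2 powr (- \<mu> * real_of_int (k + l))) = 1"
    by (subst ennreal_mult[symmetric]) (simp_all flip: powr_add)
  finally show ?thesis by simp
qed

lemma nn_integral_block_repr_le:
  assumes h: "block_repr r' s' (- a) \<mu> c b h" and [measurable]: "F \<in> borel_measurable lebesgue"
  shows "(\<integral>\<^sup>+ z. F z * modulus h z \<partial>lebesgue) \<le> ennreal (\<Sum>k. norm (c k)) * morrey_herz_norm r s a \<mu> F"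
proof -
  from h have blk: "herz_block r' s' (- a) \<mu> (b k)" for k
    by (auto simp: block_repr_def)
  then have [measurable]: "b k \<in> borel_measurable lebesgue" for k
    by (auto simp: herz_block_def)
  have "(\<integral>\<^sup>+ z. F z * modulus h z \<partial>lebesgue) \<le>
      (\<integral>\<^sup>+ z. (\<Sum>k. ennreal (norm (c k)) * (F z * modulus (b k) z)) \<partial>lebesgue)"
  proof (rule nn_integral_mono_AE)
    have "AE z in lebesgue. (\<lambda>k. c k * b k z) sums h z"
      using h by (simp add: block_repr_def)
    then show "AE z in lebesgue. F z * modulus h z \<le> (\<Sum>k. ennreal (norm (c k)) * (F z * modulus (b k) z))"
    proof (rule eventually_mono)
      fix z assume "(\<lambda>k. c k * b k z) sums h z"
      from norm_sums_le_suminf[OF this]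
      have "F z * modulus h z \<le> F z * (\<Sum>k. ennreal (norm (c k)) * modulus (b k) z)"
        by (intro mult_left_mono) (auto simp: modulus_def norm_mult ennreal_mult)
      also have "\<dots> = (\<Sum>k. ennreal (norm (c k)) * (F z * modulus (b k) z))"
        by (subst ennreal_suminf_cmult[symmetric]) (simp add: mult_ac)
      finally show "F z * modulus h z \<le> (\<Sum>k. ennreal (norm (c k)) * (F z * modulus (b k) z))" .
    qed
  qed
  also have "\<dots> = (\<Sum>k. ennreal (norm (c k)) * (\<integral>\<^sup>+ z. F z * modulus (b k) z \<partial>lebesgue))"
    by (subst nn_integral_suminf) (auto simp: nn_integral_cmult)
  also have "\<dots> \<le> (\<Sum>k. ennreal (norm (c k)) * morrey_herz_norm r s a \<mu> F)"
    using blk by (intro suminf_le mult_left_mono nn_integral_block_le) auto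
  also have "\<dots> = ennreal (\<Sum>k. norm (c k)) * morrey_herz_norm r s a \<mu> F"
    using h by (simp add: suminf_ennreal2 block_repr_def)
  finally show ?thesis .
qed

text \<open>The infimum in the block norm need not be attained, so a representation with coefficient
  sum below t + d is used and the excess d M is absorbed into an arbitrary e.\<close>

lemma nn_integral_block_herz_le:
  assumes N: "block_herz_norm r' s' (- a) \<mu> h \<le> ennreal t" and "0 \<le> t"
    and [measurable]: "F \<in> borel_measurable lebesgue"
    and fin: "morrey_herz_norm r s a \<mu> F < top"
  shows "(\<integral>\<^sup>+ z. F z * modulus h z \<partial>lebesgue) \<le> ennreal t * morrey_herz_norm r s a \<mu> F"
proof (rule ennreal_le_epsilon)
  obtain M where M: "morrey_herz_norm r s a \<mu> F = ennreal M" "0 \<le> M"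
    using fin by (cases "morrey_herz_norm r s a \<mu> F") auto
  fix e :: real assume "0 < e"
  \<comment> \<open>The denominator M + 1 gives d M \<le> e and is positive also for M = 0.\<close>
  define d where "d = e / (M + 1)"
  have "0 < d" using \<open>0 < e\<close> M by (simp add: d_def)
  then have "ennreal t < ennreal (t + d)"
    using \<open>0 \<le> t\<close> by (intro ennreal_lessI) auto
  with N have "block_herz_norm r' s' (- a) \<mu> h < ennreal (t + d)" by simp
  then obtain c b where h: "block_repr r' s' (- a) \<mu> c b h" and c: "ennreal (\<Sum>k. norm (c k)) < ennreal (t + d)"
    by (rule block_herz_normE)
  have "(\<integral>\<^sup>+ z. F z * modulus h z \<partial>lebesgue) \<le> ennreal (t + d) * ennreal M"
    using nn_integral_block_repr_le[OF h, of F] mult_right_mono[OF less_imp_le[OF c], of "ennreal M"]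
    unfolding M(1) by auto
  also have "\<dots> = ennreal (t * M + d * M)"
    using \<open>0 \<le> t\<close> \<open>0 < d\<close> M by (simp add: algebra_simps flip: ennreal_mult)
  also have "\<dots> \<le> ennreal (t * M + e)"
    using \<open>0 < e\<close> M by (intro ennreal_leI) (simp add: d_def field_simps)
  also have "\<dots> = ennreal t * morrey_herz_norm r s a \<mu> F + ennreal e"
    using \<open>0 \<le> t\<close> \<open>0 < e\<close> M by (simp add: ennreal_mult)
  finally show "(\<integral>\<^sup>+ z. F z * modulus h z \<partial>lebesgue) \<le> ennreal t * morrey_herz_norm r s a \<mu> F + ennreal e" .
qed

text \<open>The extremal function is scaled by 2^(-\<mu>(k+l)), the largest norm that a block on
  this rectangle may have. It vanishes wherever g does, so it inherits the support
  condition.\<close>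

lemma ex_dual_block:
  fixes g :: "(real ^ 'n) \<times> (real ^ 'm) \<Rightarrow> real"
  assumes g: "g \<in> borel_measurable lebesgue" "\<And>z. 0 \<le> g z" "\<And>z. g z \<le> K"
    and S: "finite S" "\<And>z. g z \<noteq> 0 \<Longrightarrow> \<exists>ij\<in>S. z \<in> cell ij"
    and R: "\<And>z. g z \<noteq> 0 \<Longrightarrow> z \<in> dyadic_rect k l"
    and nz: "herz_norm r s a (\<lambda>z. ennreal (g z)) \<noteq> 0"
  obtains b where "herz_block r' s' (- a) \<mu> b"
    "(\<integral>\<^sup>+ z. ennreal (g z) * modulus b z \<partial>lebesgue) =
      ennreal (2 powr (- \<mu> * real_of_int (k + l))) * herz_norm r s a (\<lambda>z. ennreal (g z))"
proof -
  obtain b where [measurable]: "b \<in> borel_measurable lebesgue" and b: "\<And>z. 0 \<le> b z" "\<And>z. g z = 0 \<Longrightarrow> b z = 0"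
    and le: "herz_norm r' s' (- a) (\<lambda>z. ennreal (b z)) \<le> 1"
    and eq: "(\<integral>\<^sup>+ z. ennreal (g z) * ennreal (b z) \<partial>lebesgue) = herz_norm r s a (\<lambda>z. ennreal (g z))"
    using herz_dual[OF r s g S nz] by blast
  define \<kappa> where "\<kappa> = 2 powr (- \<mu> * real_of_int (k + l))"
  have "\<kappa> > 0" by (simp add: \<kappa>_def)
  define B where "B z = complex_of_real (\<kappa> * b z)" for z
  have B: "modulus B = (\<lambda>z. ennreal \<kappa> * ennreal (b z))"
    using b \<open>\<kappa> > 0\<close> by (auto simp: modulus_def B_def norm_mult ennreal_mult less_imp_le)
  have cmult: "herz_norm r' s' (- a) (\<lambda>z. ennreal \<kappa> * ennreal (b z)) = ennreal \<kappa> * herz_norm r' s' (- a) (\<lambda>z. ennreal (b z))"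
  proof -
    have "(\<integral>\<^sup>+ z. (ennreal \<kappa> * ennreal (b z)) epowr r' * indicator (cell ij) z \<partial>lebesgue) =
        ennreal \<kappa> epowr r' * (\<integral>\<^sup>+ z. ennreal (b z) epowr r' * indicator (cell ij) z \<partial>lebesgue)" for ij
      by (subst nn_integral_cmult[symmetric]) (auto simp: epowr_mult mult.assoc)
    then have "herz_norm r' s' (- a) (\<lambda>z. ennreal \<kappa> * ennreal (b z)) =
        (\<integral>\<^sup>+ ij. ennreal \<kappa> epowr s' * (ennreal (weight (s' * - a) ij) *
          (\<integral>\<^sup>+ z. ennreal (b z) epowr r' * indicator (cell ij) z \<partial>lebesgue) epowr (s' / r')) \<partial>count_space UNIV) epowr (1 / s')"
      using r s by (simp add: herz_norm_eq epowr_mult epowr_epowr mult_ac)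
    also have "\<dots> = ennreal \<kappa> * herz_norm r' s' (- a) (\<lambda>z. ennreal (b z))"
      using s by (simp add: nn_integral_cmult herz_norm_eq epowr_mult epowr_epowr)
    finally show ?thesis .
  qed
  have "herz_norm r' s' (- a) (modulus B) \<le> ennreal \<kappa>"
    unfolding B cmult using mult_left_mono[OF le, of "ennreal \<kappa>"] by simp
  moreover have "B z = 0" if "z \<notin> dyadic_rect k l" for z
    using that R[of z] b(2)[of z] by (auto simp: B_def)
  moreover have "B \<in> borel_measurable lebesgue"
    unfolding B_def by measurable
  ultimately have "herz_block r' s' (- a) \<mu> B"
    unfolding herz_block_def \<kappa>_def by (intro conjI exI[of _ k] exI[of _ l]) auto
  moreover have "(\<integral>\<^sup>+ z. ennreal (g z) * modulus B z \<partial>lebesgue) = ennreal \<kappa> * herz_norm r s a (\<lambda>z. ennreal (g z))"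
    unfolding B eq[symmetric] using g(1) by (subst nn_integral_cmult[symmetric]) (auto simp: mult_ac)
  ultimately show ?thesis
    using that unfolding \<kappa>_def by blast
qed

text \<open>Inside a fixed dyadic rectangle, G is cut off at height N and restricted to finitely
  many cells; each truncation is tested with its own extremal block, and N tends to infinity. A
  truncation of norm 0 satisfies the bound trivially, so blocks that vanish almost everywhere never
  have to be tested.\<close>

lemma morrey_herz_norm_leI:
  fixes G :: "(real ^ 'n) \<times> (real ^ 'm) \<Rightarrow> ennreal"
  assumes [measurable]: "G \<in> borel_measurable lebesgue"
    and le: "\<And>b. herz_block r' s' (- a) \<mu> b \<Longrightarrow> \<not> (AE z in lebesgue. b z = 0) \<Longrightarrow>
      (\<integral>\<^sup>+ z. G z * modulus b z \<partial>lebesgue) \<le> A"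
  shows "morrey_herz_norm r s a \<mu> G \<le> A"
  unfolding morrey_herz_norm_def
proof (rule SUP_least, clarify)
  fix k l :: int
  define S where "S N = {- int N..int N} \<times> {- int N..int N}" for N
  define U :: "nat \<Rightarrow> ((real ^ 'n) \<times> (real ^ 'm)) set" where "U N = dyadic_rect k l \<inter> (\<Union>ij\<in>S N. cell ij)" for N
  define g where "g N z = enn2real (min (G z) (of_nat N)) * indicator (U N) z" for N z
  have fin: "finite (S N)" for N by (simp add: S_def)
  then have [measurable]: "U N \<in> sets lebesgue" for N
    unfolding U_def by (intro sets.Int sets.finite_UN) auto
  have g_meas [measurable]: "g N \<in> borel_measurable lebesgue" for N
    unfolding g_def by measurable
  have g0: "0 \<le> g N z" for N z by (simp add: g_def)
  have min_fin: "min (G z) (of_nat N) < top" for z N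
    by (simp add: min_less_iff_disj ennreal_of_nat_eq_real_of_nat)
  have eg: "ennreal (g N z) = min (G z) (of_nat N) * indicator (U N) z" for N z
    using min_fin[of z N] by (simp add: g_def split: split_indicator)
  have gK: "g N z \<le> real N" for N z
  proof -
    have "ennreal (g N z) \<le> of_nat N"
      unfolding eg by (simp split: split_indicator)
    then show ?thesis by (simp add: ennreal_of_nat_eq_real_of_nat)
  qed
  have U_mono: "U M \<subseteq> U N" if "M \<le> N" for M N
    using that unfolding U_def S_def by fastforce
  have g_le: "ennreal (g N z) \<le> G z" for N z
    unfolding eg by (simp split: split_indicator)
  have mono: "incseq (\<lambda>N z. ennreal (g N z))"
    unfolding incseq_def le_fun_def eg
  proof (intro allI impI mult_mono min.mono order_refl)
    fix M N :: nat and z assume "M \<le> N"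
    then show "of_nat M \<le> (of_nat N :: ennreal)" by simp
    show "indicator (U M) z \<le> (indicator (U N) z :: ennreal)"
      using U_mono[OF \<open>M \<le> N\<close>] by (auto simp: indicator_def)
  qed auto
  \<comment> \<open>The truncations increase to G at every point of the rectangle that lies in some
    cell; the remaining points are invisible to the Herz norm.\<close>
  have "herz_norm r s a (\<lambda>z. G z * indicator (dyadic_rect k l) z) = herz_norm r s a (\<lambda>z. SUP N. ennreal (g N z))"
  proof (rule herz_norm_cong_cell)
    fix z :: "(real ^ 'n) \<times> (real ^ 'm)" and ij assume z: "z \<in> cell ij"
    show "G z * indicator (dyadic_rect k l) z = (SUP N. ennreal (g N z))"
    proof (rule antisym)
      show "G z * indicator (dyadic_rect k l) z \<le> (SUP N. ennreal (g N z))"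
      proof (cases "z \<in> dyadic_rect k l")
        case True
        show ?thesis
        proof (rule le_SUP_iff[THEN iffD2], intro allI impI)
          fix y assume "y < G z * indicator (dyadic_rect k l) z"
          with True have y: "y < G z" by simp
          then obtain M :: nat where M: "y < of_nat M"
            using less_le_trans[OF y top_greatest]
            unfolding ennreal_SUP_of_nat_eq_top[symmetric] less_SUP_iff by blast
          \<comment> \<open>One index serves both cutoffs: the height exceeds y, and the cell that
            contains z is among those kept. As y is any number below \<open>G z\<close>, the value
            \<open>G z = top\<close> needs no separate treatment.\<close>
          define N where "N = M + nat \<bar>fst ij\<bar> + nat \<bar>snd ij\<bar>"
          have "ij \<in> S N" by (cases ij) (auto simp: S_def N_def)
          then have "z \<in> U N" using z True by (auto simp: U_def)
          moreover have "y < of_nat N"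
            using M by (rule less_le_trans) (simp add: N_def)
          ultimately have "y < ennreal (g N z)" using y by (simp add: eg)
          then show "\<exists>N\<in>UNIV. y < ennreal (g N z)" by blast
        qed
      qed simp
      show "(SUP N. ennreal (g N z)) \<le> G z * indicator (dyadic_rect k l) z"
        by (rule SUP_least) (auto simp: eg U_def split: split_indicator)
    qed
  qed
  also have "\<dots> = (SUP N. herz_norm r s a (\<lambda>z. ennreal (g N z)))"
    using r s mono by (intro herz_norm_SUP) auto
  finally have eq: "herz_norm r s a (\<lambda>z. G z * indicator (dyadic_rect k l) z) = (SUP N. herz_norm r s a (\<lambda>z. ennreal (g N z)))" .
  have "ennreal (2 powr (- \<mu> * real_of_int (k + l))) * herz_norm r s a (\<lambda>z. ennreal (g N z)) \<le> A" for N
  proof (cases "herz_norm r s a (\<lambda>z. ennreal (g N z)) = 0")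
    case nz: False
    have "\<exists>ij\<in>S N. z \<in> cell ij" "z \<in> dyadic_rect k l" if "g N z \<noteq> 0" for z
      using that by (auto simp: g_def U_def split: split_indicator_asm)
    then obtain b where b: "herz_block r' s' (- a) \<mu> b"
      and int: "(\<integral>\<^sup>+ z. ennreal (g N z) * modulus b z \<partial>lebesgue) =
        ennreal (2 powr (- \<mu> * real_of_int (k + l))) * herz_norm r s a (\<lambda>z. ennreal (g N z))"
      using ex_dual_block[OF g_meas g0 gK fin _ _ nz, where k = k and l = l] by blast
    \<comment> \<open>The pairing of \<open>g N\<close> with b is a positive multiple of a nonzero
      norm, which a block vanishing almost everywhere could not produce.\<close>
    have b_nz: "\<not> (AE z in lebesgue. b z = 0)"
    proof
      assume "AE z in lebesgue. b z = 0"
      then have "AE z in lebesgue. ennreal (g N z) * modulus b z = 0"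
        by (rule eventually_mono) (simp add: modulus_def)
      then have "(\<integral>\<^sup>+ z. ennreal (g N z) * modulus b z \<partial>lebesgue) = (\<integral>\<^sup>+ z. 0 \<partial>(lebesgue :: ((real ^ 'n) \<times> (real ^ 'm)) measure))"
        by (rule nn_integral_cong_AE)
      with int nz show False by simp
    qed
    have "(\<integral>\<^sup>+ z. ennreal (g N z) * modulus b z \<partial>lebesgue) \<le> (\<integral>\<^sup>+ z. G z * modulus b z \<partial>lebesgue)"
      by (intro nn_integral_mono mult_right_mono g_le) auto
    with int le[OF b b_nz] show ?thesis by simp
  qed simp
  then have "(SUP N. ennreal (2 powr (- \<mu> * real_of_int (k + l))) * herz_norm r s a (\<lambda>z. ennreal (g N z))) \<le> A"
    by (intro SUP_least)
  then show "ennreal (2 powr (- real_of_int (k + l) * \<mu>)) * herz_norm r s a (\<lambda>z. G z * indicator (dyadic_rect k l) z) \<le> A"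
    unfolding eq SUP_mult_left_ennreal by (simp only: mult_minus_left mult.commute[of "real_of_int (k + l)" \<mu>])
qed

end

subsection \<open>The Rubio de Francia operator\<close>

text \<open>All coordinates of such points lie between 1/4 and 1/2, which are half the sides of the
  two cubes that bound \<open>annulus 0\<close>. It provides an open set inside the cell (0,
  0).\<close>

lemma cube_subset_annulus: "cube (\<chi> i. 3 / 8) (1 / 4) \<subseteq> annulus 0"
proof
  fix y :: "real ^ 'd" assume y: "y \<in> cube (\<chi> i. 3 / 8) (1 / 4)"
  have "\<bar>y $ i\<bar> < 1 / 2 \<and> \<not> \<bar>y $ i\<bar> < 1 / 4" for i
  proof -
    have "\<bar>y $ i - 3 / 8\<bar> < 1 / 8" using y by (simp add: cube_def)
    then show ?thesis by linarith
  qed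
  then show "y \<in> annulus 0"
    by (simp add: annulus_def dyadic_cube_def cube_def)
qed

lemma cube_subset_cube:
  fixes x :: "real ^ 'd"
  assumes "t + 2 * norm x \<le> u"
  shows "cube 0 t \<subseteq> cube x u"
proof
  fix y :: "real ^ 'd" assume y: "y \<in> cube 0 t"
  have "\<bar>y $ i - x $ i\<bar> < u / 2" for i
  proof -
    have "\<bar>y $ i\<bar> < t / 2" using y by (simp add: cube_def)
    moreover have "\<bar>x $ i\<bar> \<le> norm x" by (rule component_le_norm_cart)
    ultimately show ?thesis using assms by linarith
  qed
  then show "y \<in> cube x u" by (simp add: cube_def)
qed

lemma emeasure_cell_pos: "emeasure lebesgue (cell (0, 0) :: ((real ^ 'n) \<times> (real ^ 'm)) set) \<noteq> 0"
proof -
  define B :: "((real ^ 'n) \<times> (real ^ 'm)) set" where "B = cube (\<chi> i. 3 / 8) (1 / 4) \<times> cube (\<chi> i. 3 / 8) (1 / 4)"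
  have "(\<chi> i. 3 / 8, \<chi> i. 3 / 8) \<in> B" by (simp add: B_def cube_def)
  moreover have "open B" by (simp add: B_def open_Times open_cube)
  ultimately have "\<not> negligible B" using open_not_negligible by blast
  moreover have "B \<subseteq> cell (0, 0)"
    unfolding B_def cell_def fst_conv snd_conv by (intro Sigma_mono cube_subset_annulus)
  ultimately have "\<not> negligible (cell (0, 0) :: ((real ^ 'n) \<times> (real ^ 'm)) set)"
    using negligible_subset by blast
  then show ?thesis
    using sets_cell by (auto simp: negligible_iff_null_sets null_sets_def simp del: emeasure_completion)
qed

text \<open>The maximal function sees only integrals, so equality almost everywhere becomes equality
  at every point. This lets an iterate be replaced by a representative before the next
  application.\<close>

lemma strong_maximal_cong_AE:
  assumes "AE z in lebesgue. F z = G z"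
  shows "strong_maximal F = strong_maximal G"
proof -
  have "(\<integral>\<^sup>+ w\<in>R. F w \<partial>lebesgue) = (\<integral>\<^sup>+ w\<in>R. G w \<partial>lebesgue)" for R
    using assms by (intro nn_integral_cong_AE) (auto elim: eventually_mono)
  then show ?thesis by (simp add: strong_maximal_def fun_eq_iff)
qed

lemma sets_rectangles: "R \<in> rectangles \<Longrightarrow> R \<in> sets lebesgue"
  by (auto simp: rectangles_def intro!: sets_completionI_sets borel_open open_Times open_cube)

lemma strong_maximal_cmult:
  assumes [measurable]: "F \<in> borel_measurable lebesgue"
  shows "strong_maximal (\<lambda>z. c * F z) z = c * strong_maximal F z"
proof -
  have "(\<integral>\<^sup>+ w\<in>R. c * F w \<partial>lebesgue) / emeasure lebesgue R = c * ((\<integral>\<^sup>+ w\<in>R. F w \<partial>lebesgue) / emeasure lebesgue R)"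
    if "R \<in> rectangles" for R
  proof -
    note [measurable] = sets_rectangles[OF that]
    have "(\<integral>\<^sup>+ w\<in>R. c * F w \<partial>lebesgue) = c * (\<integral>\<^sup>+ w\<in>R. F w \<partial>lebesgue)"
      by (subst nn_integral_cmult[symmetric]) (auto simp: mult.assoc)
    then show ?thesis by (simp add: ennreal_times_divide)
  qed
  then show ?thesis
    unfolding strong_maximal_def SUP_mult_left_ennreal by (intro SUP_cong) auto
qed

lemma strong_maximal_pos:
  fixes F :: "(real ^ 'n) \<times> (real ^ 'm) \<Rightarrow> ennreal"
  assumes "(\<integral>\<^sup>+ w\<in>dyadic_rect k l. F w \<partial>lebesgue) \<noteq> 0"
  shows "strong_maximal F z \<noteq> 0"
proof -
  \<comment> \<open>Cubes of this side length centered at the components of z contain the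
    corresponding dyadic cubes centered at 0. The rectangle has finite measure, so the average of F
    over it is not 0.\<close>
  define \<rho> where "\<rho> = 2 powi k + 2 powi l + 2 * norm z"
  have "\<rho> > 0" unfolding \<rho>_def by (smt (verit) zero_less_power_int norm_ge_zero)
  define R where "R = cube (fst z) \<rho> \<times> cube (snd z) \<rho>"
  have R: "R \<in> rectangles" "z \<in> R"
    using \<open>\<rho> > 0\<close> unfolding R_def rectangles_def by (auto simp: cube_def mem_Times_iff)
  have pos: "(2 :: real) powi k > 0" "(2 :: real) powi l > 0" by simp_all
  have "norm (fst z) \<le> norm z" "norm (snd z) \<le> norm z"
    by (metis norm_fst_le prod.collapse, metis norm_snd_le prod.collapse)
  with pos have "2 powi k + 2 * norm (fst z) \<le> \<rho>" "2 powi l + 2 * norm (snd z) \<le> \<rho>"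
    unfolding \<rho>_def by linarith+
  then have "dyadic_rect k l \<subseteq> R"
    unfolding dyadic_rect_def R_def dyadic_cube_def by (intro Sigma_mono cube_subset_cube)
  then have "(\<integral>\<^sup>+ w\<in>dyadic_rect k l. F w \<partial>lebesgue) \<le> (\<integral>\<^sup>+ w\<in>R. F w \<partial>lebesgue)"
    by (intro nn_integral_mono mult_left_mono) (auto simp: indicator_def)
  moreover have "emeasure lebesgue R < top"
  proof -
    have "R \<in> lmeasurable"
      using sets_rectangles[OF R(1)]
      by (intro bounded_set_imp_lmeasurable) (auto simp: R_def intro: bounded_Times bounded_cube)
    then show ?thesis by (auto simp: fmeasurable_def)
  qed
  ultimately have "(\<integral>\<^sup>+ w\<in>R. F w \<partial>lebesgue) / emeasure lebesgue R \<noteq> 0"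
    using assms by auto
  moreover have "(\<integral>\<^sup>+ w\<in>R. F w \<partial>lebesgue) / emeasure lebesgue R \<le> strong_maximal F z"
    unfolding strong_maximal_def using R by (intro SUP_upper) auto
  ultimately show ?thesis by auto
qed

lemma rubio_de_francia_ge: "modulus h z \<le> rubio_de_francia N h z"
proof -
  have "(\<Sum>k\<in>{0}. (strong_maximal ^^ k) (modulus h) z / (2 ^ k * strong_maximal_opnorm N ^ k)) \<le> rubio_de_francia N h z"
    unfolding rubio_de_francia_def by (intro sum_le_suminf) auto
  then show ?thesis by (simp add: divide_ennreal_def)
qed

section \<open>Iterates of the maximal operator in the block space\<close>

context herz_duality
begin

text \<open>A rectangle either misses the cell (0, 0) or has both indices nonnegative, and then the
  Morrey factor is at most 1. The indicator serves as a test function that detects block norm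
  0.\<close>

lemma morrey_herz_norm_cell_finite:
  assumes "0 < \<mu>"
  shows "morrey_herz_norm r s a \<mu> (indicator (cell (0, 0)) :: (real ^ 'n) \<times> (real ^ 'm) \<Rightarrow> ennreal) < top"
proof -
  let ?F = "indicator (cell (0, 0)) :: (real ^ 'n) \<times> (real ^ 'm) \<Rightarrow> ennreal"
  have "(\<integral>\<^sup>+ z. ?F z epowr r * indicator (cell ij) z \<partial>lebesgue) = (if ij = (0, 0) then emeasure lebesgue (cell (0, 0) :: ((real ^ 'n) \<times> (real ^ 'm)) set) else 0)" for ij
  proof -
    have "?F z epowr r * indicator (cell ij) z = (if ij = (0, 0) then ?F z else 0)" for z
      by (auto simp: indicator_def dest: cell_disjoint)
    then show ?thesis by simp
  qed
  then have "herz_norm r s a ?F = (\<integral>\<^sup>+ ij. ennreal (weight (s * a) ij) *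
      (if ij = (0, 0) then emeasure lebesgue (cell (0, 0) :: ((real ^ 'n) \<times> (real ^ 'm)) set) else 0) epowr (s / r) \<partial>count_space UNIV) epowr (1 / s)"
    by (simp add: herz_norm_eq)
  also have "(\<integral>\<^sup>+ ij. ennreal (weight (s * a) ij) *
      (if ij = (0, 0) then emeasure lebesgue (cell (0, 0) :: ((real ^ 'n) \<times> (real ^ 'm)) set) else 0) epowr (s / r) \<partial>count_space UNIV)
      = (\<Sum>ij\<in>{(0, 0)}. ennreal (weight (s * a) ij) *
      (if ij = (0, 0) then emeasure lebesgue (cell (0, 0) :: ((real ^ 'n) \<times> (real ^ 'm)) set) else 0) epowr (s / r))"
    by (intro nn_integral_count_space') auto
  also have "\<dots> = ennreal (weight (s * a) (0, 0)) * emeasure lebesgue (cell (0, 0) :: ((real ^ 'n) \<times> (real ^ 'm)) set) epowr (s / r)"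
    by (simp del: emeasure_completion)
  finally have fin: "herz_norm r s a ?F < top"
    using emeasure_cell_finite[of "(0, 0)", where ?'a = 'n and ?'b = 'm]
    by (simp add: ennreal_mult_less_top del: emeasure_completion)
  have "morrey_herz_norm r s a \<mu> ?F \<le> herz_norm r s a ?F"
    unfolding morrey_herz_norm_def
  proof (rule SUP_least, clarify)
    fix k l :: int
    show "ennreal (2 powr (- real_of_int (k + l) * \<mu>)) * herz_norm r s a (\<lambda>z. ?F z * indicator (dyadic_rect k l) z) \<le> herz_norm r s a ?F"
    proof (cases "0 \<le> k \<and> 0 \<le> l")
      case True
      then have "2 powr (- real_of_int (k + l) * \<mu>) \<le> 2 powr 0"
        using assms by (intro powr_mono) (auto intro!: mult_nonpos_nonneg)
      then have "ennreal (2 powr (- real_of_int (k + l) * \<mu>)) \<le> 1"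
        by (simp del: powr_eq_one_iff)
      moreover have "herz_norm r s a (\<lambda>z. ?F z * indicator (dyadic_rect k l) z) \<le> herz_norm r s a ?F"
        using r s by (intro herz_norm_mono) (auto simp: indicator_def)
      ultimately have "ennreal (2 powr (- real_of_int (k + l) * \<mu>)) * herz_norm r s a (\<lambda>z. ?F z * indicator (dyadic_rect k l) z)
          \<le> 1 * herz_norm r s a ?F"
        by (rule mult_mono) auto
      then show ?thesis by simp
    next
      case False
      then have "(\<lambda>z. ?F z * indicator (dyadic_rect k l) z) = (\<lambda>z. 0)"
        by (auto simp: fun_eq_iff indicator_def cell_dyadic_rect_iff)
      then show ?thesis by (simp add: herz_norm_eq)
    qed
  qed
  with fin show ?thesis by simp
qed

text \<open>The extremal block of the indicator of the cell (0, 0) is a concrete nonzero element of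
  the unit ball of the block space.\<close>

lemma ex_unit_block:
  obtains b :: "(real ^ 'n) \<times> (real ^ 'm) \<Rightarrow> complex" where "herz_block r' s' (- a) \<mu> b"
    "(\<integral>\<^sup>+ z. indicator (cell (0, 0)) z * modulus b z \<partial>lebesgue) \<noteq> 0"
proof -
  let ?C = "cell (0, 0) :: ((real ^ 'n) \<times> (real ^ 'm)) set"
  have nz: "herz_norm r s a (\<lambda>z. ennreal (indicator ?C z)) \<noteq> 0"
  proof -
    let ?f = "\<lambda>ij. ennreal (weight (s * a) ij) *
      (\<integral>\<^sup>+ z. ennreal (indicator ?C z) epowr r * indicator (cell ij) z \<partial>lebesgue) epowr (s / r)"
    have "(\<integral>\<^sup>+ z. ennreal (indicator ?C z) epowr r * indicator ?C z \<partial>lebesgue) = (\<integral>\<^sup>+ z. indicator ?C z \<partial>lebesgue)"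
      by (intro nn_integral_cong) (simp split: split_indicator)
    then have "0 < ?f (0, 0)"
      using emeasure_cell_pos[where ?'n = 'n and ?'m = 'm]
      by (simp add: ennreal_eq_0_iff not_le zero_less_iff_neq_zero del: emeasure_completion)
    also have "?f (0, 0) \<le> (\<integral>\<^sup>+ ij. ?f ij \<partial>count_space UNIV)"
      by (rule nn_integral_ge_point) simp
    finally show ?thesis
      unfolding zero_less_iff_neq_zero herz_norm_eq epowr_eq_0_iff .
  qed
  have "(\<lambda>z. indicator ?C z) \<in> borel_measurable lebesgue" by measurable
  moreover have "0 \<le> indicat_real ?C z" "indicat_real ?C z \<le> 1" for z
    by (simp_all split: split_indicator)
  moreover have "\<exists>ij\<in>{(0, 0)}. z \<in> cell ij" "z \<in> dyadic_rect 0 0" if "indicat_real ?C z \<noteq> 0" for z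
    using that by (auto simp: cell_dyadic_rect_iff split: split_indicator_asm)
  moreover have "finite {(0, 0) :: int \<times> int}" by simp
  ultimately obtain b where b: "herz_block r' s' (- a) \<mu> b"
    and int: "(\<integral>\<^sup>+ z. ennreal (indicator ?C z) * modulus b z \<partial>lebesgue) =
      ennreal (2 powr (- \<mu> * real_of_int (0 + 0))) * herz_norm r s a (\<lambda>z. ennreal (indicator ?C z))"
    using ex_dual_block[of "indicator ?C" 1 "{(0, 0)}" 0 0, OF _ _ _ _ _ _ nz] by blast
  have "ennreal (indicator ?C z) = indicator ?C z" for z
    by (simp split: split_indicator)
  with b int nz show ?thesis
    using that[of b] by simp
qed

text \<open>Division by 0 would make the terms of the Rubio de Francia series infinite. The maximal
  function of a nonzero block is positive everywhere; if its block norm were 0, its pairing with the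
  indicator of the cell (0, 0) would vanish, although that cell has positive measure.\<close>

lemma strong_maximal_opnorm_nonzero:
  assumes "0 < \<mu>"
  shows "strong_maximal_opnorm (block_herz_norm r' s' (- a) \<mu> :: ((real ^ 'n) \<times> (real ^ 'm) \<Rightarrow> complex) \<Rightarrow> ennreal) \<noteq> 0"
proof
  let ?N = "block_herz_norm r' s' (- a) \<mu> :: ((real ^ 'n) \<times> (real ^ 'm) \<Rightarrow> complex) \<Rightarrow> ennreal"
  let ?C = "cell (0, 0) :: ((real ^ 'n) \<times> (real ^ 'm)) set"
  assume 0: "strong_maximal_opnorm ?N = 0"
  obtain b where b: "herz_block r' s' (- a) \<mu> b" and nz: "(\<integral>\<^sup>+ z. indicator ?C z * modulus b z \<partial>lebesgue) \<noteq> 0"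
    by (rule ex_unit_block)
  have "(\<integral>\<^sup>+ w\<in>dyadic_rect 0 0. modulus b w \<partial>lebesgue) \<noteq> 0"
  proof -
    have "(\<integral>\<^sup>+ z. indicator ?C z * modulus b z \<partial>lebesgue) \<le> (\<integral>\<^sup>+ w\<in>dyadic_rect 0 0. modulus b w \<partial>lebesgue)"
      by (intro nn_integral_mono) (auto simp: indicator_def cell_dyadic_rect_iff)
    then show ?thesis using nz by auto
  qed
  then have pos: "strong_maximal (modulus b) z \<noteq> 0" for z
    by (rule strong_maximal_pos)
  have "norm_ext ?N (strong_maximal (modulus b)) \<le> strong_maximal_opnorm ?N"
    unfolding strong_maximal_opnorm_def using block_herz_norm_block_le_1[OF b] by (intro SUP_upper) auto
  with 0 have ext0: "norm_ext ?N (strong_maximal (modulus b)) = 0" by simp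
  define u where "u z = complex_of_real (enn2real (strong_maximal (modulus b) z))" for z
  have ae: "AE z in lebesgue. strong_maximal (modulus b) z < \<infinity>" and N0: "?N u = 0"
    using ext0 by (auto simp: norm_ext_def u_def[abs_def] split: if_splits)
  have [measurable]: "u \<in> borel_measurable lebesgue"
    using N0 by (intro borel_measurable_block_herz[where r = r' and s = s' and a = "- a" and \<mu> = \<mu>]) simp
  have "(\<integral>\<^sup>+ z. indicator ?C z * modulus u z \<partial>lebesgue) \<le> ennreal 0 * morrey_herz_norm r s a \<mu> (indicator ?C)"
    using N0 morrey_herz_norm_cell_finite[OF assms] by (intro nn_integral_block_herz_le) auto
  then have "AE z in lebesgue. indicator ?C z * modulus u z = 0"
    by (subst nn_integral_0_iff_AE[symmetric]) auto
  with ae have "AE z in lebesgue. z \<notin> ?C"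
  proof eventually_elim
    case (elim z)
    then have "modulus u z \<noteq> 0"
      using pos[of z] by (auto simp: modulus_def u_def enn2real_eq_0_iff)
    with elim show ?case by (auto simp: indicator_def)
  qed
  then have "?C \<in> null_sets lebesgue"
    using AE_iff_null_sets[OF sets_cell, of "(0, 0)"] by blast
  then show False
    using null_setsD1 emeasure_cell_pos by blast
qed

text \<open>Besides the bound \<kappa>^k, the function u provides a measurable representative of the
  iterate. The operator norm is a supremum over the unit ball, so each step divides by \<kappa>^k,
  applies the maximal operator, and scales back by homogeneity.\<close>

lemma ex_strong_maximal_iterate:
  fixes h :: "(real ^ 'n) \<times> (real ^ 'm) \<Rightarrow> complex"
  assumes N: "block_herz_norm r' s' (- a) \<mu> h \<le> 1"
    and \<kappa>: "strong_maximal_opnorm (block_herz_norm r' s' (- a) \<mu> :: ((real ^ 'n) \<times> (real ^ 'm) \<Rightarrow> complex) \<Rightarrow> ennreal) = ennreal \<kappa>" "0 < \<kappa>"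
  shows "\<exists>u. block_herz_norm r' s' (- a) \<mu> u \<le> ennreal (\<kappa> ^ k) \<and>
    (AE z in lebesgue. (strong_maximal ^^ k) (modulus h) z = modulus u z)"
proof (induction k)
  case 0
  then show ?case using N by auto
next
  case (Suc k)
  let ?N = "block_herz_norm r' s' (- a) \<mu> :: ((real ^ 'n) \<times> (real ^ 'm) \<Rightarrow> complex) \<Rightarrow> ennreal"
  from Suc obtain u where u: "?N u \<le> ennreal (\<kappa> ^ k)"
    and ae: "AE z in lebesgue. (strong_maximal ^^ k) (modulus h) z = modulus u z"
    by blast
  define v where "v z = complex_of_real (1 / \<kappa> ^ k) * u z" for z
  have [measurable]: "u \<in> borel_measurable lebesgue"
    using u by (intro borel_measurable_block_herz[where r = r' and s = s' and a = "- a" and \<mu> = \<mu>]) (auto intro: le_less_trans)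
  then have [measurable]: "v \<in> borel_measurable lebesgue"
    unfolding v_def by measurable
  have "?N v \<le> ennreal (1 / \<kappa> ^ k) * ?N u"
    unfolding v_def using \<kappa> by (intro block_herz_norm_cmult_le) simp
  also have "\<dots> \<le> ennreal (1 / \<kappa> ^ k) * ennreal (\<kappa> ^ k)"
    using u by (rule mult_left_mono) simp
  also have "\<dots> = 1"
    using \<kappa> by (simp flip: ennreal_mult)
  finally have "norm_ext ?N (strong_maximal (modulus v)) \<le> strong_maximal_opnorm ?N"
    unfolding strong_maximal_opnorm_def by (intro SUP_upper) auto
  then have ext: "norm_ext ?N (strong_maximal (modulus v)) \<le> ennreal \<kappa>"
    by (simp add: \<kappa>)
  define w where "w z = complex_of_real (enn2real (strong_maximal (modulus v) z))" for z
  have fin: "AE z in lebesgue. strong_maximal (modulus v) z < \<infinity>" and w: "?N w \<le> ennreal \<kappa>"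
    using ext by (auto simp: norm_ext_def w_def[abs_def] top_unique split: if_splits)
  have mu: "modulus u = (\<lambda>z. ennreal (\<kappa> ^ k) * modulus v z)"
    using \<kappa> by (auto simp: modulus_def v_def norm_mult norm_divide norm_power simp flip: ennreal_mult)
  \<comment> \<open>This holds at every z: replacing the k-th iterate by \<open>modulus u\<close> on
    a set of full measure does not change its maximal function.\<close>
  have M: "(strong_maximal ^^ Suc k) (modulus h) z = ennreal (\<kappa> ^ k) * strong_maximal (modulus v) z" for z
    using strong_maximal_cong_AE[OF ae] strong_maximal_cmult[of "modulus v" "ennreal (\<kappa> ^ k)" z]
    by (simp add: mu)
  show ?case
  proof (intro exI conjI)
    have "?N (\<lambda>z. complex_of_real (\<kappa> ^ k) * w z) \<le> ennreal (\<kappa> ^ k) * ?N w"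
      using \<kappa> by (intro block_herz_norm_cmult_le) simp
    also have "\<dots> \<le> ennreal (\<kappa> ^ k) * ennreal \<kappa>"
      using w by (rule mult_left_mono) simp
    also have "\<dots> = ennreal (\<kappa> ^ Suc k)"
      using \<kappa> by (simp add: mult.commute flip: ennreal_mult)
    finally show "?N (\<lambda>z. complex_of_real (\<kappa> ^ k) * w z) \<le> ennreal (\<kappa> ^ Suc k)" .
    show "AE z in lebesgue. (strong_maximal ^^ Suc k) (modulus h) z = modulus (\<lambda>z. complex_of_real (\<kappa> ^ k) * w z) z"
      using fin unfolding M
    proof (rule eventually_mono)
      fix z assume "strong_maximal (modulus v) z < \<infinity>"
      then show "ennreal (\<kappa> ^ k) * strong_maximal (modulus v) z = modulus (\<lambda>z. complex_of_real (\<kappa> ^ k) * w z) z"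
        using \<kappa> by (simp add: modulus_def norm_mult norm_power w_def ennreal_mult)
    qed
  qed
qed

text \<open>\<open>W\<close> is the same series with the measurable representatives of the iterates,
  so that integral and sum can be exchanged. The k-th term is bounded by \<kappa>^k / (2 \<kappa>)^k
  = 2^(-k) times the Morrey-Herz norm, and 2 is the sum of the geometric series.\<close>

lemma ex_rubio_de_francia_measurable:
  fixes h :: "(real ^ 'n) \<times> (real ^ 'm) \<Rightarrow> complex"
  assumes "0 < \<mu>" and N: "block_herz_norm r' s' (- a) \<mu> h \<le> 1"
  obtains W where "W \<in> borel_measurable lebesgue"
    "AE z in lebesgue. rubio_de_francia (block_herz_norm r' s' (- a) \<mu>) h z = W z"
    "\<And>F. F \<in> borel_measurable lebesgue \<Longrightarrow>
      (\<integral>\<^sup>+ z. F z * W z \<partial>lebesgue) \<le> 2 * morrey_herz_norm r s a \<mu> F"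
proof -
  let ?N = "block_herz_norm r' s' (- a) \<mu> :: ((real ^ 'n) \<times> (real ^ 'm) \<Rightarrow> complex) \<Rightarrow> ennreal"
  have triv: "x \<le> 2 * morrey_herz_norm r s a \<mu> F" if "morrey_herz_norm r s a \<mu> F = top" for x F
    using that by (simp add: ennreal_mult_top)
  have [measurable]: "h \<in> borel_measurable lebesgue"
    using N by (intro borel_measurable_block_herz[where r = r' and s = s' and a = "- a" and \<mu> = \<mu>]) (auto intro: le_less_trans)
  show ?thesis
  proof (cases "strong_maximal_opnorm ?N")
    case top
    \<comment> \<open>All terms but the first vanish, since \<open>x / \<infinity> = 0\<close>.\<close>
    have "rubio_de_francia ?N h z = modulus h z" for z
    proof -
      have "(\<Sum>k. (strong_maximal ^^ k) (modulus h) z / (2 ^ k * top ^ k)) =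
          (\<Sum>k\<in>{0}. (strong_maximal ^^ k) (modulus h) z / (2 ^ k * top ^ k))"
        by (rule suminf_finite) (auto simp: ennreal_mult_top)
      then show ?thesis by (simp add: rubio_de_francia_def top divide_ennreal_def)
    qed
    moreover have "(\<integral>\<^sup>+ z. F z * modulus h z \<partial>lebesgue) \<le> 2 * morrey_herz_norm r s a \<mu> F"
      if "F \<in> borel_measurable lebesgue" for F
    proof (cases "morrey_herz_norm r s a \<mu> F = top")
      case False
      then have "(\<integral>\<^sup>+ z. F z * modulus h z \<partial>lebesgue) \<le> ennreal 1 * morrey_herz_norm r s a \<mu> F"
        using N that by (intro nn_integral_block_herz_le) (auto simp: less_top)
      also have "\<dots> \<le> 2 * morrey_herz_norm r s a \<mu> F"
        by (intro mult_right_mono) auto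
      finally show ?thesis .
    qed (rule triv)
    ultimately show ?thesis by (intro that[of "modulus h"]) auto
  next
    case (real \<kappa>)
    have "0 < \<kappa>"
      using real strong_maximal_opnorm_nonzero[OF \<open>0 < \<mu>\<close>, where ?'n = 'n and ?'m = 'm] by (cases "\<kappa> = 0") auto
    have "\<exists>u. \<forall>k. ?N (u k) \<le> ennreal (\<kappa> ^ k) \<and>
        (AE z in lebesgue. (strong_maximal ^^ k) (modulus h) z = modulus (u k) z)"
      by (intro choice allI ex_strong_maximal_iterate N real(2) \<open>0 < \<kappa>\<close>)
    then obtain u where u: "\<And>k. ?N (u k) \<le> ennreal (\<kappa> ^ k)"
      and ae: "\<And>k. AE z in lebesgue. (strong_maximal ^^ k) (modulus h) z = modulus (u k) z"
      by blast
    have [measurable]: "u k \<in> borel_measurable lebesgue" for k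
      using u[of k] by (intro borel_measurable_block_herz[where r = r' and s = s' and a = "- a" and \<mu> = \<mu>]) (auto intro: le_less_trans)
    define W where "W z = (\<Sum>k. ennreal (1 / (2 * \<kappa>) ^ k) * modulus (u k) z)" for z
    have coeff: "x / (2 ^ k * ennreal \<kappa> ^ k) = ennreal (1 / (2 * \<kappa>) ^ k) * x" for x :: ennreal and k
    proof -
      have "(2 :: ennreal) ^ k * ennreal \<kappa> ^ k = ennreal ((2 * \<kappa>) ^ k)"
        using \<open>0 < \<kappa>\<close> by (simp add: power_mult_distrib ennreal_mult ennreal_power flip: ennreal_numeral)
      then show ?thesis
        using \<open>0 < \<kappa>\<close> by (simp add: divide_ennreal_def inverse_ennreal divide_inverse mult.commute)
    qed
    show ?thesis
    proof (rule that[of W])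
      show "W \<in> borel_measurable lebesgue"
        unfolding W_def by measurable
      have "AE z in lebesgue. \<forall>k. (strong_maximal ^^ k) (modulus h) z = modulus (u k) z"
        unfolding AE_all_countable using ae by blast
      then show "AE z in lebesgue. rubio_de_francia ?N h z = W z"
        by (rule eventually_mono) (simp add: rubio_de_francia_def W_def real coeff)
      fix F :: "(real ^ 'n) \<times> (real ^ 'm) \<Rightarrow> ennreal" assume [measurable]: "F \<in> borel_measurable lebesgue"
      show "(\<integral>\<^sup>+ z. F z * W z \<partial>lebesgue) \<le> 2 * morrey_herz_norm r s a \<mu> F"
      proof (cases "morrey_herz_norm r s a \<mu> F = top")
        case False
        have "(\<integral>\<^sup>+ z. F z * W z \<partial>lebesgue) = (\<integral>\<^sup>+ z. (\<Sum>k. ennreal (1 / (2 * \<kappa>) ^ k) * (F z * modulus (u k) z)) \<partial>lebesgue)"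
          unfolding W_def by (subst ennreal_suminf_cmult[symmetric]) (simp add: mult.left_commute)
        also have "\<dots> = (\<Sum>k. ennreal (1 / (2 * \<kappa>) ^ k) * (\<integral>\<^sup>+ z. F z * modulus (u k) z \<partial>lebesgue))"
          by (subst nn_integral_suminf) (auto simp: nn_integral_cmult)
        also have "\<dots> \<le> (\<Sum>k. ennreal ((1 / 2) ^ k) * morrey_herz_norm r s a \<mu> F)"
        proof (intro suminf_le)
          fix k
          have "ennreal (1 / (2 * \<kappa>) ^ k) * (\<integral>\<^sup>+ z. F z * modulus (u k) z \<partial>lebesgue) \<le>
              ennreal (1 / (2 * \<kappa>) ^ k) * (ennreal (\<kappa> ^ k) * morrey_herz_norm r s a \<mu> F)"
            using False u[of k] \<open>0 < \<kappa>\<close>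
            by (intro mult_left_mono nn_integral_block_herz_le) (auto simp: less_top)
          also have "\<dots> = ennreal (1 / (2 * \<kappa>) ^ k * \<kappa> ^ k) * morrey_herz_norm r s a \<mu> F"
            using \<open>0 < \<kappa>\<close> by (subst ennreal_mult) (auto simp: mult.assoc)
          also have "1 / (2 * \<kappa>) ^ k * \<kappa> ^ k = (1 / 2) ^ k"
            using \<open>0 < \<kappa>\<close> by (simp add: power_mult_distrib power_divide)
          finally show "ennreal (1 / (2 * \<kappa>) ^ k) * (\<integral>\<^sup>+ z. F z * modulus (u k) z \<partial>lebesgue) \<le>
              ennreal ((1 / 2) ^ k) * morrey_herz_norm r s a \<mu> F" .
        qed auto
        also have "\<dots> = ennreal (\<Sum>k. (1 / 2) ^ k) * morrey_herz_norm r s a \<mu> F"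
          by (simp add: suminf_ennreal2 summable_geometric)
        also have "ennreal (\<Sum>k. (1 / 2) ^ k) = 2"
          by (simp add: suminf_geometric)
        finally show ?thesis .
      qed (rule triv)
    qed
  qed
qed

end

subsection \<open>Extrapolation\<close>

lemma conj_exponent_conjugate:
  assumes "r > 1"
  shows "conj_exponent r > 1" "1 / r + 1 / conj_exponent r = 1"
  using assms by (simp_all add: conj_exponent_def field_simps)

text \<open>Dividing both exponents by t leaves their quotient unchanged, and q \<alpha> = (q / t)(t
  \<alpha>) keeps the weights; only the outer power changes.\<close>

lemma herz_norm_epowr:
  assumes "0 < t" "0 < p" "0 < q"
  shows "herz_norm p q \<alpha> (\<lambda>z. F z epowr (1 / t)) = herz_norm (p / t) (q / t) (t * \<alpha>) F epowr (1 / t)"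
  using assms by (simp add: herz_norm_eq epowr_epowr)

lemma morrey_herz_norm_epowr:
  assumes "0 < t" "0 < p" "0 < q"
  shows "morrey_herz_norm p q \<alpha> lam (\<lambda>z. F z epowr (1 / t)) =
    morrey_herz_norm (p / t) (q / t) (t * \<alpha>) (t * lam) F epowr (1 / t)"
proof -
  have "ennreal (2 powr (- real_of_int (k + l) * lam)) * herz_norm p q \<alpha> (\<lambda>z. F z epowr (1 / t) * indicator (dyadic_rect k l) z) =
      (ennreal (2 powr (- real_of_int (k + l) * (t * lam))) *
        herz_norm (p / t) (q / t) (t * \<alpha>) (\<lambda>z. F z * indicator (dyadic_rect k l) z)) epowr (1 / t)" for k l
    unfolding epowr_indicator[symmetric] herz_norm_epowr[OF assms]
    using assms by (simp add: epowr_mult epowr_ennreal powr_powr)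
  then show ?thesis
    using assms unfolding morrey_herz_norm_def by (subst epowr_SUP) (auto intro!: SUP_cong)
qed

section \<open>Local integrability of functions with finite Morrey-Herz norm\<close>

lemma finite_powi_bounded:
  fixes c d :: real
  assumes "0 < c"
  shows "finite {k :: int. c \<le> 2 powi k \<and> 2 powi k \<le> d}"
proof (rule finite_subset)
  show "{k :: int. c \<le> 2 powi k \<and> 2 powi k \<le> d} \<subseteq> {\<lfloor>log 2 c\<rfloor>..\<lceil>log 2 d\<rceil>}"
  proof clarsimp
    fix k :: int assume k: "c \<le> 2 powi k" "2 powi k \<le> d"
    have "0 < d" using k assms by linarith
    have "log 2 c \<le> real_of_int k" "real_of_int k \<le> log 2 d"
      using k assms \<open>0 < d\<close> by (simp_all add: log_le_iff le_log_iff powr_real_of_int')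
    then show "\<lfloor>log 2 c\<rfloor> \<le> k \<and> k \<le> \<lceil>log 2 d\<rceil>"
      by linarith
  qed
qed simp

text \<open>On the annulus, the sup norm lies between 2^k / 4 and 2^k / 2. The dimension enters
  through the comparison of the Euclidean norm with the sum of the coordinates.\<close>

lemma annulus_norm_bounds:
  fixes x :: "real ^ 'd"
  assumes "x \<in> annulus k"
  shows "2 powi k \<le> 4 * norm x" "norm x \<le> real CARD('d) * 2 powi k"
proof -
  obtain i where "\<bar>x $ i\<bar> \<ge> 2 powi (k - 1) / 2"
    using assms by (auto simp: annulus_def dyadic_cube_def cube_def not_less)
  moreover have "\<bar>x $ i\<bar> \<le> norm x" by (rule component_le_norm_cart)
  moreover have "(2 :: real) powi (k - 1) = 2 powi k / 2" by (simp add: power_int_diff)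
  ultimately show "2 powi k \<le> 4 * norm x" by linarith
  have "\<bar>x $ i\<bar> \<le> 2 powi k" for i
  proof -
    have "\<bar>x $ i\<bar> < 2 powi k / 2"
      using assms by (simp add: annulus_def dyadic_cube_def cube_def)
    moreover have "(2 :: real) powi k > 0" by simp
    ultimately show ?thesis by linarith
  qed
  then have "(\<Sum>i\<in>UNIV. \<bar>x $ i\<bar>) \<le> (\<Sum>i\<in>(UNIV :: 'd set). 2 powi k)"
    by (intro sum_mono)
  with norm_le_l1_cart[of x] show "norm x \<le> real CARD('d) * 2 powi k"
    by simp
qed

lemma finite_annuli_compact:
  fixes K :: "(real ^ 'd) set"
  assumes "compact K" "0 \<notin> K"
  shows "finite {k. annulus k \<inter> K \<noteq> {}}"
proof -
  obtain B where B: "\<And>x. x \<in> K \<Longrightarrow> norm x \<le> B"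
    using compact_imp_bounded[OF \<open>compact K\<close>] by (auto simp: bounded_iff)
  have "open (- K)" using \<open>compact K\<close> by (simp add: compact_imp_closed open_Compl)
  then obtain e where e: "0 < e" "ball 0 e \<subseteq> - K"
    using \<open>0 \<notin> K\<close> by (auto simp: open_contains_ball)
  have "{k. annulus k \<inter> K \<noteq> {}} \<subseteq> {k. e / real CARD('d) \<le> 2 powi k \<and> 2 powi k \<le> 4 * B}"
  proof clarsimp
    fix k assume "annulus k \<inter> K \<noteq> {}"
    then obtain x where x: "x \<in> annulus k" "x \<in> K" by auto
    then have "e \<le> norm x" using e(2) by (force simp: subset_iff)
    with annulus_norm_bounds[OF x(1)] B[OF x(2)]
    show "e / real CARD('d) \<le> 2 powi k \<and> 2 powi k \<le> 4 * B"
      by (auto simp: field_simps)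
  qed
  then show ?thesis
    by (rule finite_subset) (use e in \<open>simp add: finite_powi_bounded\<close>)
qed

text \<open>A compact set that avoids zero components meets only finitely many cells, and a finite
  norm forces a finite integral over each of them. With this, a norm bound for Tf yields membership
  in the space.\<close>

lemma Lp_loc_of_morrey_herz_norm:
  fixes f :: "(real ^ 'n) \<times> (real ^ 'm) \<Rightarrow> complex"
  assumes [measurable]: "f \<in> borel_measurable lebesgue" and pq: "0 < p" "0 < q"
    and fin: "morrey_herz_norm p q \<alpha> lam (modulus f) < \<infinity>"
  shows "f \<in> Lp_loc p ((UNIV - {0}) \<times> (UNIV - {0}))"
  unfolding Lp_loc_def
proof (intro CollectI conjI allI impI)
  have cell_fin: "(\<integral>\<^sup>+ z. modulus f z epowr p * indicator (cell ij) z \<partial>lebesgue) < top" (is "?J ij < top") for ij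
  proof -
    let ?h = "herz_norm p q \<alpha> (\<lambda>z. modulus f z * indicator (dyadic_rect (fst ij) (snd ij)) z)"
    let ?g = "\<lambda>kl. ennreal (weight (q * \<alpha>) kl) *
      (\<integral>\<^sup>+ z. (modulus f z * indicator (dyadic_rect (fst ij) (snd ij)) z) epowr p * indicator (cell kl) z \<partial>lebesgue) epowr (q / p)"
    have "?h < top"
      using herz_norm_dyadic_rect_le[of p q \<alpha> "modulus f" "fst ij" "snd ij" lam] fin
      by (auto intro: le_less_trans simp: ennreal_mult_less_top)
    then have "(\<integral>\<^sup>+ kl. ?g kl \<partial>count_space UNIV) < top"
      by (simp add: herz_norm_eq)
    with nn_integral_ge_point[of ij UNIV ?g] have "?g ij < top"
      by (auto intro: le_less_trans)
    moreover have "(\<integral>\<^sup>+ z. (modulus f z * indicator (dyadic_rect (fst ij) (snd ij)) z) epowr p * indicator (cell ij) z \<partial>lebesgue) = ?J ij"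
      by (intro nn_integral_cong) (auto simp: cell_dyadic_rect_iff split: split_indicator)
    moreover have "ennreal (weight (q * \<alpha>) ij) \<noteq> 0"
      by (simp add: ennreal_eq_0_iff not_le)
    ultimately show ?thesis
      by (auto simp: ennreal_mult_less_top)
  qed
  fix K :: "((real ^ 'n) \<times> (real ^ 'm)) set"
  assume K: "compact K \<and> K \<subseteq> (UNIV - {0}) \<times> (UNIV - {0})"
  define S where "S = {k. annulus k \<inter> fst ` K \<noteq> {}} \<times> {k. annulus k \<inter> snd ` K \<noteq> {}}"
  have "finite S"
    unfolding S_def using K
    by (intro finite_cartesian_product finite_annuli_compact compact_continuous_image continuous_intros) auto
  have cover: "\<exists>ij\<in>S. z \<in> cell ij" if "z \<in> K" for z
  proof -
    have "fst z \<noteq> 0" "snd z \<noteq> 0" using K that by auto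
    then obtain i j where "fst z \<in> annulus i" "snd z \<in> annulus j" using ex_annulus by metis
    with that show ?thesis
      by (intro bexI[of _ "(i, j)"]) (auto simp: cell_def S_def mem_Times_iff)
  qed
  have "(\<integral>\<^sup>+ z\<in>K. modulus f z epowr p \<partial>lebesgue) \<le> (\<integral>\<^sup>+ z. (\<Sum>ij\<in>S. modulus f z epowr p * indicator (cell ij) z) \<partial>lebesgue)"
  proof (rule nn_integral_mono)
    fix z
    show "modulus f z epowr p * indicator K z \<le> (\<Sum>ij\<in>S. modulus f z epowr p * indicator (cell ij) z)"
    proof (cases "z \<in> K")
      case True
      then obtain ij where "ij \<in> S" "z \<in> cell ij" using cover by blast
      then show ?thesis
        using True member_le_sum[of ij S "\<lambda>ij. modulus f z epowr p * indicator (cell ij) z"] \<open>finite S\<close> by simp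
    qed simp
  qed
  also have "\<dots> = (\<Sum>ij\<in>S. ?J ij)"
    by (intro nn_integral_sum) measurable
  also have "\<dots> < \<infinity>"
    using cell_fin \<open>finite S\<close> by simp
  finally show "(\<integral>\<^sup>+ z\<in>K. modulus f z epowr p \<partial>lebesgue) < \<infinity>" .
qed fact

text \<open>F and G are arbitrary so that they can be p_0-th powers of moduli as well as sums of
  such powers. The constant 2 is the one from the geometric series.\<close>

lemma (in herz_duality) extrapolation:
  fixes F G :: "(real ^ 'n) \<times> (real ^ 'm) \<Rightarrow> ennreal"
  assumes \<mu>: "0 < \<mu>" and [measurable]: "F \<in> borel_measurable lebesgue" "G \<in> borel_measurable lebesgue"
    and le: "\<And>h. block_herz_norm r' s' (- a) \<mu> h \<le> 1 \<Longrightarrow> \<not> (AE z in lebesgue. h z = 0) \<Longrightarrow>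
      (\<integral>\<^sup>+ z. G z * rubio_de_francia (block_herz_norm r' s' (- a) \<mu>) h z \<partial>lebesgue)
        \<le> c * (\<integral>\<^sup>+ z. F z * rubio_de_francia (block_herz_norm r' s' (- a) \<mu>) h z \<partial>lebesgue)"
  shows "morrey_herz_norm r s a \<mu> G \<le> 2 * c * morrey_herz_norm r s a \<mu> F"
proof (rule morrey_herz_norm_leI)
  let ?R = "rubio_de_francia (block_herz_norm r' s' (- a) \<mu>)"
  fix b :: "(real ^ 'n) \<times> (real ^ 'm) \<Rightarrow> complex"
  assume b: "herz_block r' s' (- a) \<mu> b" "\<not> (AE z in lebesgue. b z = 0)"
  note N = block_herz_norm_block_le_1[OF b(1)]
  obtain W where W: "AE z in lebesgue. ?R b z = W z"
    "\<And>F. F \<in> borel_measurable lebesgue \<Longrightarrow> (\<integral>\<^sup>+ z. F z * W z \<partial>lebesgue) \<le> 2 * morrey_herz_norm r s a \<mu> F"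
    by (rule ex_rubio_de_francia_measurable[OF \<mu> N]) blast
  have "(\<integral>\<^sup>+ z. G z * modulus b z \<partial>lebesgue) \<le> (\<integral>\<^sup>+ z. G z * ?R b z \<partial>lebesgue)"
    by (intro nn_integral_mono mult_left_mono rubio_de_francia_ge) auto
  also have "\<dots> \<le> c * (\<integral>\<^sup>+ z. F z * ?R b z \<partial>lebesgue)"
    by (rule le[OF N b(2)])
  also have "(\<integral>\<^sup>+ z. F z * ?R b z \<partial>lebesgue) = (\<integral>\<^sup>+ z. F z * W z \<partial>lebesgue)"
    using W(1) by (intro nn_integral_cong_AE) (auto elim: eventually_mono)
  also have "c * \<dots> \<le> c * (2 * morrey_herz_norm r s a \<mu> F)"
    by (intro mult_left_mono W(2)) auto
  finally show "(\<integral>\<^sup>+ z. G z * modulus b z \<partial>lebesgue) \<le> 2 * c * morrey_herz_norm r s a \<mu> F"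
    by (simp add: mult_ac)
qed measurable

theorem theorem4p3:
  fixes \<alpha> lam p\<^sub>0 p q :: real
    and T :: "((real ^ 'n) \<times> (real ^ 'm) \<Rightarrow> complex) \<Rightarrow> ((real ^ 'n) \<times> (real ^ 'm) \<Rightarrow> complex)"
    and n m :: real
    and X :: "((real ^ 'n) \<times> (real ^ 'm) \<Rightarrow> complex) set"
    and normX :: "((real ^ 'n) \<times> (real ^ 'm) \<Rightarrow> complex) \<Rightarrow> ennreal"
  defines "n \<equiv> real CARD('n)" and "m \<equiv> real CARD('m)"
  defines "X \<equiv> block_herz_space (conj_exponent (p / p\<^sub>0)) (conj_exponent (q / p\<^sub>0)) (- p\<^sub>0 * \<alpha>) (p\<^sub>0 * lam)"
    and "normX \<equiv> block_herz_norm (conj_exponent (p / p\<^sub>0)) (conj_exponent (q / p\<^sub>0)) (- p\<^sub>0 * \<alpha>) (p\<^sub>0 * lam)"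
  assumes "0 < p\<^sub>0" "p\<^sub>0 < p" "p\<^sub>0 < q"
    and "0 < lam" "lam < min (\<alpha> + n / p) (\<alpha> + m / p)"
    and "max (- n / p) (- m / p) < \<alpha>"
    and "\<alpha> < min (n * (1 / p\<^sub>0 - 1 / p)) (m * (1 / p\<^sub>0 - 1 / p))"
    and T_bounded: "\<exists>C>0. \<forall>h\<in>X. \<not> (AE z in lebesgue. h z = 0) \<and> normX h \<le> 1 \<longrightarrow>
      (\<forall>f \<in> Lp_space p\<^sub>0 (rubio_de_francia normX h).
         T f \<in> borel_measurable lebesgue \<and>
         Lp_norm p\<^sub>0 (rubio_de_francia normX h) (modulus (T f))
           \<le> ennreal C * Lp_norm p\<^sub>0 (rubio_de_francia normX h) (modulus f))"
  shows "(\<exists>C'>0. \<forall>f \<in> morrey_herz_space p q \<alpha> lam.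
            T f \<in> morrey_herz_space p q \<alpha> lam \<and>
            morrey_herz_norm p q \<alpha> lam (modulus (T f)) \<le> ennreal C' * morrey_herz_norm p q \<alpha> lam (modulus f))
       \<and> (\<exists>C''>0. \<forall>f :: nat \<Rightarrow> (real ^ 'n) \<times> (real ^ 'm) \<Rightarrow> complex.
            (\<forall>i. f i \<in> morrey_herz_space p q \<alpha> lam) \<longrightarrow>
            morrey_herz_norm p q \<alpha> lam (\<lambda>z. (\<Sum>i. modulus (T (f i)) z epowr p\<^sub>0) epowr (1 / p\<^sub>0))
              \<le> ennreal C'' * morrey_herz_norm p q \<alpha> lam (\<lambda>z. (\<Sum>i. modulus (f i) z epowr p\<^sub>0) epowr (1 / p\<^sub>0)))"
proof -
  note p0 = \<open>0 < p\<^sub>0\<close>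
  have pq: "0 < p" "0 < q" using assms by linarith+
  define r s a \<mu> where "r = p / p\<^sub>0" and "s = q / p\<^sub>0" and "a = p\<^sub>0 * \<alpha>" and "\<mu> = p\<^sub>0 * lam"
  let ?M = "morrey_herz_space p q \<alpha> lam :: ((real ^ 'n) \<times> (real ^ 'm) \<Rightarrow> complex) set"
  let ?R = "rubio_de_francia normX"
  have "r > 1" "s > 1" "\<mu> > 0"
    using assms by (simp_all add: r_def s_def \<mu>_def)
  interpret herz_duality r "conj_exponent r" s "conj_exponent s" a \<mu>
    using conj_exponent_conjugate[OF \<open>r > 1\<close>] conj_exponent_conjugate[OF \<open>s > 1\<close>] \<open>r > 1\<close> \<open>s > 1\<close> by unfold_locales
  have normX: "normX = block_herz_norm (conj_exponent r) (conj_exponent s) (- a) \<mu>"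
    by (simp add: normX_def r_def s_def a_def \<mu>_def)
  have X: "h \<in> X" if "normX h \<le> 1" for h
    using that unfolding normX_def X_def by (intro block_herz_norm_finite_imp_space) (auto intro: le_less_trans)
  from T_bounded obtain C where "C > 0" and C: "\<And>h f. h \<in> X \<Longrightarrow> \<not> (AE z in lebesgue. h z = 0) \<Longrightarrow> normX h \<le> 1 \<Longrightarrow>
      f \<in> Lp_space p\<^sub>0 (?R h) \<Longrightarrow> T f \<in> borel_measurable lebesgue \<and>
        Lp_norm p\<^sub>0 (?R h) (modulus (T f)) \<le> ennreal C * Lp_norm p\<^sub>0 (?R h) (modulus f)"
    by blast
  \<comment> \<open>Raising the weighted bound to the power p_0 gives C^p_0 between integrals; the
    duality argument contributes the factor 2, and the final root gives \<open>C'\<close>.\<close>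
  define c where "c = ennreal (C powr p\<^sub>0)"
  define C' where "C' = (2 * C powr p\<^sub>0) powr (1 / p\<^sub>0)"
  have "C' > 0" using \<open>C > 0\<close> by (simp add: C'_def)
  have rescale: "morrey_herz_norm p q \<alpha> lam (\<lambda>z. F z epowr (1 / p\<^sub>0)) = morrey_herz_norm r s a \<mu> F epowr (1 / p\<^sub>0)"
    for F :: "(real ^ 'n) \<times> (real ^ 'm) \<Rightarrow> ennreal"
    unfolding r_def s_def a_def \<mu>_def by (rule morrey_herz_norm_epowr[OF p0 pq])
  have modulus_p0: "modulus f = (\<lambda>z. (modulus f z epowr p\<^sub>0) epowr (1 / p\<^sub>0))" for f :: "(real ^ 'n) \<times> (real ^ 'm) \<Rightarrow> complex"
    using p0 by (simp add: epowr_epowr)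
  have M_meas [measurable]: "f \<in> borel_measurable lebesgue" if "f \<in> ?M" for f
    using that by (simp add: morrey_herz_space_def Lp_loc_def)
  have M_norm: "morrey_herz_norm r s a \<mu> (\<lambda>z. modulus f z epowr p\<^sub>0) < top" if "f \<in> ?M" for f
  proof -
    have "morrey_herz_norm p q \<alpha> lam (modulus f) < top"
      using that by (simp add: morrey_herz_space_def)
    then show ?thesis
      by (subst (asm) modulus_p0) (simp add: rescale)
  qed
  \<comment> \<open>The pairing bound for \<open>?R h\<close> shows that f belongs to every weighted
    space that occurs in the hypothesis on T. Hence T f is defined and the weighted bound applies to
    it.\<close>
  have T: "T f \<in> borel_measurable lebesgue \<and>
      (\<integral>\<^sup>+ z. modulus (T f) z epowr p\<^sub>0 * ?R h z \<partial>lebesgue) \<le> c * (\<integral>\<^sup>+ z. modulus f z epowr p\<^sub>0 * ?R h z \<partial>lebesgue)"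
    if h: "normX h \<le> 1" "\<not> (AE z in lebesgue. h z = 0)" and f: "f \<in> ?M" for f h
  proof -
    note [measurable] = M_meas[OF f]
    obtain W where W: "AE z in lebesgue. ?R h z = W z"
      "\<And>F. F \<in> borel_measurable lebesgue \<Longrightarrow> (\<integral>\<^sup>+ z. F z * W z \<partial>lebesgue) \<le> 2 * morrey_herz_norm r s a \<mu> F"
      unfolding normX by (rule ex_rubio_de_francia_measurable[OF \<open>\<mu> > 0\<close> h(1)[unfolded normX]]) blast
    have "(\<integral>\<^sup>+ z. modulus f z epowr p\<^sub>0 * ?R h z \<partial>lebesgue) = (\<integral>\<^sup>+ z. modulus f z epowr p\<^sub>0 * W z \<partial>lebesgue)"
      using W(1) by (intro nn_integral_cong_AE) (auto elim: eventually_mono)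
    also have "\<dots> \<le> 2 * morrey_herz_norm r s a \<mu> (\<lambda>z. modulus f z epowr p\<^sub>0)"
      by (intro W(2)) measurable
    also have "\<dots> < top"
      using M_norm[OF f] by (simp add: ennreal_mult_less_top)
    finally have "f \<in> Lp_space p\<^sub>0 (?R h)"
      by (simp add: Lp_space_def Lp_norm_def)
    from C[OF X[OF h(1)] h(2,1) this] have meas: "T f \<in> borel_measurable lebesgue"
      and le: "Lp_norm p\<^sub>0 (?R h) (modulus (T f)) \<le> ennreal C * Lp_norm p\<^sub>0 (?R h) (modulus f)"
      by auto
    from epowr_mono[OF le, of p\<^sub>0] meas show ?thesis
      using p0 \<open>C > 0\<close> by (simp add: Lp_norm_def epowr_mult epowr_epowr epowr_ennreal c_def)
  qed
  \<comment> \<open>Measurability of T f comes from the hypothesis for any one admissible h, so a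
    nonzero element of the unit ball has to be exhibited.\<close>
  have T_meas: "T f \<in> borel_measurable lebesgue" if "f \<in> ?M" for f
  proof -
    obtain b :: "(real ^ 'n) \<times> (real ^ 'm) \<Rightarrow> complex" where b: "herz_block (conj_exponent r) (conj_exponent s) (- a) \<mu> b"
      and int: "(\<integral>\<^sup>+ z. indicator (cell (0, 0)) z * modulus b z \<partial>lebesgue) \<noteq> 0"
      by (rule ex_unit_block)
    have "\<not> (AE z in lebesgue. b z = 0)"
    proof
      assume "AE z in lebesgue. b z = 0"
      then have "(\<integral>\<^sup>+ z. indicator (cell (0, 0)) z * modulus b z \<partial>lebesgue) = (\<integral>\<^sup>+ z. 0 \<partial>(lebesgue :: ((real ^ 'n) \<times> (real ^ 'm)) measure))"
        by (intro nn_integral_cong_AE) (auto simp: modulus_def elim: eventually_mono)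
      with int show False by simp
    qed
    with T[of b f] that block_herz_norm_block_le_1[OF b] show ?thesis
      by (simp add: normX)
  qed
  have extrapolate: "morrey_herz_norm p q \<alpha> lam (\<lambda>z. G z epowr (1 / p\<^sub>0)) \<le> ennreal C' * morrey_herz_norm p q \<alpha> lam (\<lambda>z. F z epowr (1 / p\<^sub>0))"
    if [measurable]: "F \<in> borel_measurable lebesgue" "G \<in> borel_measurable lebesgue"
      and le: "\<And>h. normX h \<le> 1 \<Longrightarrow> \<not> (AE z in lebesgue. h z = 0) \<Longrightarrow>
        (\<integral>\<^sup>+ z. G z * ?R h z \<partial>lebesgue) \<le> c * (\<integral>\<^sup>+ z. F z * ?R h z \<partial>lebesgue)"
    for F G :: "(real ^ 'n) \<times> (real ^ 'm) \<Rightarrow> ennreal"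
  proof -
    have "morrey_herz_norm r s a \<mu> G \<le> 2 * c * morrey_herz_norm r s a \<mu> F"
      using le unfolding normX by (intro extrapolation \<open>\<mu> > 0\<close>) auto
    then have "morrey_herz_norm r s a \<mu> G epowr (1 / p\<^sub>0) \<le> (2 * c * morrey_herz_norm r s a \<mu> F) epowr (1 / p\<^sub>0)"
      using p0 by (intro epowr_mono) auto
    also have "\<dots> = (2 * c) epowr (1 / p\<^sub>0) * morrey_herz_norm r s a \<mu> F epowr (1 / p\<^sub>0)"
      by (rule epowr_mult)
    also have "(2 * c) epowr (1 / p\<^sub>0) = ennreal C'"
      using \<open>C > 0\<close> by (simp add: c_def C'_def epowr_ennreal ennreal_mult flip: ennreal_numeral ennreal_mult)
    finally show ?thesis by (simp add: rescale)
  qed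
  have scalar: "T f \<in> ?M \<and> morrey_herz_norm p q \<alpha> lam (modulus (T f)) \<le> ennreal C' * morrey_herz_norm p q \<alpha> lam (modulus f)"
    if f: "f \<in> ?M" for f
  proof -
    note [measurable] = M_meas[OF f] T_meas[OF f]
    have le: "morrey_herz_norm p q \<alpha> lam (modulus (T f)) \<le> ennreal C' * morrey_herz_norm p q \<alpha> lam (modulus f)"
      by (subst (1 2) modulus_p0, rule extrapolate) (use T f in auto)
    also have "\<dots> < top"
      using f by (auto simp: morrey_herz_space_def ennreal_mult_less_top)
    finally have "T f \<in> ?M"
      unfolding morrey_herz_space_def using pq by (auto intro: Lp_loc_of_morrey_herz_norm T_meas f)
    with le show ?thesis by blast
  qed
  have vector: "morrey_herz_norm p q \<alpha> lam (\<lambda>z. (\<Sum>i. modulus (T (f i)) z epowr p\<^sub>0) epowr (1 / p\<^sub>0))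
      \<le> ennreal C' * morrey_herz_norm p q \<alpha> lam (\<lambda>z. (\<Sum>i. modulus (f i) z epowr p\<^sub>0) epowr (1 / p\<^sub>0))"
    if f: "\<forall>i. f i \<in> ?M" for f :: "nat \<Rightarrow> (real ^ 'n) \<times> (real ^ 'm) \<Rightarrow> complex"
  proof (rule extrapolate)
    have [measurable]: "f i \<in> borel_measurable lebesgue" "T (f i) \<in> borel_measurable lebesgue" for i
      using f M_meas T_meas by auto
    show "(\<lambda>z. \<Sum>i. modulus (f i) z epowr p\<^sub>0) \<in> borel_measurable lebesgue"
      "(\<lambda>z. \<Sum>i. modulus (T (f i)) z epowr p\<^sub>0) \<in> borel_measurable lebesgue"
      by measurable
    fix h assume h: "normX h \<le> 1" "\<not> (AE z in lebesgue. h z = 0)"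
    obtain W where [measurable]: "W \<in> borel_measurable lebesgue" and W: "AE z in lebesgue. ?R h z = W z"
      unfolding normX by (rule ex_rubio_de_francia_measurable[OF \<open>\<mu> > 0\<close> h(1)[unfolded normX]]) blast
    \<comment> \<open>The exchange of sum and integral is carried out with the measurable
      representative \<open>W\<close> of \<open>?R h\<close>. It reduces the vector-valued bound to
      a sum of scalar ones.\<close>
    have swap: "(\<integral>\<^sup>+ z. (\<Sum>i. H i z) * ?R h z \<partial>lebesgue) = (\<Sum>i. \<integral>\<^sup>+ z. H i z * ?R h z \<partial>lebesgue)"
      if [measurable]: "\<And>i. H i \<in> borel_measurable lebesgue" for H :: "nat \<Rightarrow> _"
    proof -
      have R: "(\<integral>\<^sup>+ z. F z * ?R h z \<partial>lebesgue) = (\<integral>\<^sup>+ z. F z * W z \<partial>lebesgue)" for F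
        using W by (intro nn_integral_cong_AE) (auto elim: eventually_mono)
      show ?thesis
        unfolding R by (subst nn_integral_suminf[symmetric]) (auto simp: ennreal_suminf_multc)
    qed
    have "(\<integral>\<^sup>+ z. (\<Sum>i. modulus (T (f i)) z epowr p\<^sub>0) * ?R h z \<partial>lebesgue) =
        (\<Sum>i. \<integral>\<^sup>+ z. modulus (T (f i)) z epowr p\<^sub>0 * ?R h z \<partial>lebesgue)"
      by (rule swap) measurable
    also have "\<dots> \<le> (\<Sum>i. c * (\<integral>\<^sup>+ z. modulus (f i) z epowr p\<^sub>0 * ?R h z \<partial>lebesgue))"
      using T[OF h] f by (intro suminf_le) auto
    also have "\<dots> = c * (\<integral>\<^sup>+ z. (\<Sum>i. modulus (f i) z epowr p\<^sub>0) * ?R h z \<partial>lebesgue)"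
      by (subst swap) auto
    finally show "(\<integral>\<^sup>+ z. (\<Sum>i. modulus (T (f i)) z epowr p\<^sub>0) * ?R h z \<partial>lebesgue)
        \<le> c * (\<integral>\<^sup>+ z. (\<Sum>i. modulus (f i) z epowr p\<^sub>0) * ?R h z \<partial>lebesgue)" .
  qed
  show ?thesis
    using \<open>C' > 0\<close> scalar vector by blast
qed

end
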